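(* Let $G_2$ be the simply connected solvable Lie group of dimension $7$ whose Lie algebra is defined, in terms of a basis $e^1,\dots,e^7$ of left invariant $1$-forms, by $$\begin{aligned} de^1&=0,\\ de^2&=\tfrac23e^{12}+\tfrac16e^{15}-\tfrac13e^{34}+\tfrac16e^{46},\\ de^3&=-\tfrac23e^{13}+\tfrac16e^{16}-e^{24}-\tfrac16e^{45},\\ de^4&=-\tfrac23e^{14},\\ de^5&=2(e^{12}+e^{34})-e^{46},\\ de^6&=2(e^{13}+e^{42})+e^{45},\\ de^7&=2(e^{14}+e^{23})-\tfrac16e^{56}, \end{aligned}$$ and let $e_1,\dots,e_7$ be the dual basis of left invariant vector fields. The left invariant integrable qc structure on $G_2$ given by $\eta_1=e^5$, $\eta_2=e^6$, $\eta_3=e^7$, $H=\mathrm{Span}\{e_1,\dots,e_4\}$ (with $e_1,\dots,e_4$ orthonormal), $\omega_1=e^{12}+e^{34}$, $\omega_2=e^{13}+e^{42}$, $\omega_3=e^{14}+e^{23}$, is not locally qc conformally flat.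
   Context: Notation: $e^{ij}=e^i\wedge e^j$. A quaternionic contact (qc) structure on a $7$-manifold $M$ consists of a rank $4$ distribution $H$ with a metric $g$, locally the common kernel of $1$-forms $\eta_1,\eta_2,\eta_3$, and $g$-Hermitian almost complex structures $I_1,I_2,I_3$ on $H$ satisfying the quaternion identities $I_1I_2=-I_2I_1=I_3$, with $2g(I_rX,Y)=d\eta_r(X,Y)$ for $X,Y\in H$; $\omega_r(X,Y)=g(I_rX,Y)$. For a given $H$ the triplet $(\eta_1,\eta_2,\eta_3)$ is determined up to a conformal factor and the action of $SO(3)$. The standard flat qc structure on the $7$-dimensional quaternionic Heisenberg group $G(\mathbb{H})=\mathbb{H}\times\mathrm{Im}(\mathbb{H})$ is the left invariant one with coframe $\theta^1,\dots,\theta^7$ satisfying $d\theta^1=\dots=d\theta^4=0$, $d\theta^5=2(\theta^{12}+\theta^{34})$, $d\theta^6=2(\theta^{13}+\theta^{42})$, $d\theta^7=2(\theta^{14}+\theta^{23})$, $\eta_r=\theta^{4+r}$, and the horizontal metric $\sum_{i=1}^4\theta^i\otimes\theta^i$. A qc structure on $M$ is locally qc conformally flat if it is locally qc conformal to the standard flat qc structure on $G(\mathbb{H})$: each point of $M$ has a neighbourhood $U$ and a diffeomorphism $F$ of $U$ onto an open subset of $G(\mathbb{H})$ with $F^*(\theta^5,\theta^6,\theta^7)^{t}=\nu\,\Psi\,(\eta_1,\eta_2,\eta_3)^{t}$ for a positive smooth function $\nu$ and a smooth $SO(3)$-valued function $\Psi$ on $U$. *)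

theory Defs
  imports "HOL-Analysis.Analysis" "HOL-Algebra.Solvable_Groups"
begin

section \<open>Smooth maps between manifolds given by atlases\<close>

text \<open>Meaningful on open sets only; the derivative is then the full Frechet derivative.\<close>

primrec Ck_on :: "nat \<Rightarrow> 'b::real_normed_vector set \<Rightarrow> ('b \<Rightarrow> 'c::real_normed_vector) \<Rightarrow> bool" where
  "Ck_on 0 S = (\<lambda>f. continuous_on S f)"
| "Ck_on (Suc k) S = (\<lambda>f. (\<forall>x\<in>S. f differentiable (at x)) \<and>
      (\<forall>v. Ck_on k S (\<lambda>x. frechet_derivative f (at x) v)))"

definition smooth_on :: "'b::real_normed_vector set \<Rightarrow> ('b \<Rightarrow> 'c::real_normed_vector) \<Rightarrow> bool" where
  "smooth_on S f \<longleftrightarrow> (\<forall>k. Ck_on k S f)"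

text \<open>A chart is a pair of an open domain and a coordinate map; the values of the coordinate
  map outside the domain are irrelevant.  The manifold is the whole type \<open>'a\<close>; the model
  space \<open>'b\<close> determines the dimension.\<close>

type_synonym ('a, 'b) chart = "'a set \<times> ('a \<Rightarrow> 'b)"

definition chart_inv :: "('a, 'b) chart \<Rightarrow> 'b \<Rightarrow> 'a" where
  "chart_inv c = inv_into (fst c) (snd c)"

definition local_rep :: "('a \<Rightarrow> 'c) \<Rightarrow> ('a, 'b) chart \<Rightarrow> ('c, 'd) chart \<Rightarrow> 'b \<Rightarrow> 'd" where
  "local_rep f c d = snd d \<circ> f \<circ> chart_inv c"

definition smooth_atlas :: "('a::topological_space, 'b::euclidean_space) chart set \<Rightarrow> bool" where
  "smooth_atlas A \<longleftrightarrow>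
     (\<Union>c\<in>A. fst c) = UNIV \<and>
     (\<forall>c\<in>A. open (fst c) \<and> open (snd c ` fst c) \<and>
        homeomorphism (fst c) (snd c ` fst c) (snd c) (chart_inv c)) \<and>
     (\<forall>c\<in>A. \<forall>d\<in>A. smooth_on (snd c ` (fst c \<inter> fst d)) (local_rep id c d))"

definition smooth_map_on ::
  "('a::topological_space, 'b::euclidean_space) chart set \<Rightarrow>
   ('c::topological_space, 'd::euclidean_space) chart set \<Rightarrow> 'a set \<Rightarrow> ('a \<Rightarrow> 'c) \<Rightarrow> bool" where
  "smooth_map_on A B S f \<longleftrightarrow> continuous_on S f \<and>
     (\<forall>c\<in>A. \<forall>d\<in>B. smooth_on (snd c ` (fst c \<inter> S \<inter> f -` fst d)) (local_rep f c d))"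

definition smooth_function_on ::
  "('a, 'b::euclidean_space) chart set \<Rightarrow> 'a set \<Rightarrow> ('a \<Rightarrow> 'e::real_normed_vector) \<Rightarrow> bool" where
  "smooth_function_on A S f \<longleftrightarrow> (\<forall>c\<in>A. smooth_on (snd c ` (fst c \<inter> S)) (f \<circ> chart_inv c))"

definition diffeomorphism_onto_open ::
  "('a::topological_space, 'b::euclidean_space) chart set \<Rightarrow>
   ('c::topological_space, 'd::euclidean_space) chart set \<Rightarrow> 'a set \<Rightarrow> ('a \<Rightarrow> 'c) \<Rightarrow> bool" where
  "diffeomorphism_onto_open A B S f \<longleftrightarrow>
     open S \<and> open (f ` S) \<and> inj_on f S \<and>
     smooth_map_on A B S f \<and> smooth_map_on B A (f ` S) (inv_into S f)"

definition prod_atlas :: "('a, 'b) chart set \<Rightarrow> ('c, 'd) chart set \<Rightarrow> ('a \<times> 'c, 'b \<times> 'd) chart set" where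
  "prod_atlas A B = {(fst c \<times> fst d, map_prod (snd c) (snd d)) | c d. c \<in> A \<and> d \<in> B}"

abbreviation std_chart :: "('b, 'b) chart" where
  "std_chart \<equiv> (UNIV, id)"

definition lie_group :: "('a::topological_space, 'b::euclidean_space) chart set \<Rightarrow> 'a monoid \<Rightarrow> bool" where
  "lie_group A G \<longleftrightarrow> smooth_atlas A \<and> group G \<and> carrier G = UNIV \<and>
     smooth_map_on (prod_atlas A A) A UNIV (\<lambda>(p, q). p \<otimes>\<^bsub>G\<^esub> q) \<and>
     smooth_map_on A A UNIV (\<lambda>p. inv\<^bsub>G\<^esub> p)"


section \<open>Forms and vector fields\<close>

text \<open>Tensor fields are families of local representatives, one for each chart \<open>c\<close>, evaluated at
  coordinate points \<open>x \<in> snd c ` fst c\<close>; the predicates below demand the transformation law under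
  change of charts.\<close>

type_synonym ('a, 'b) vfield = "('a, 'b) chart \<Rightarrow> 'b \<Rightarrow> 'b"
type_synonym ('a, 'b) form1 = "('a, 'b) chart \<Rightarrow> 'b \<Rightarrow> 'b \<Rightarrow> real"
type_synonym ('a, 'b) form2 = "('a, 'b) chart \<Rightarrow> 'b \<Rightarrow> 'b \<Rightarrow> 'b \<Rightarrow> real"
type_synonym ('a, 'b) distribution = "('a, 'b) chart \<Rightarrow> 'b \<Rightarrow> 'b set"
type_synonym ('a, 'b) endo = "('a, 'b) chart \<Rightarrow> 'b \<Rightarrow> 'b \<Rightarrow> 'b"

text \<open>The representative in the chart \<open>c\<close> of the differential of \<open>f\<close>, and of \<open>f\<^sup>*\<alpha>\<close>, where \<open>d\<close>
  is the chart used on the target.\<close>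

definition tangent_rep ::
  "('a \<Rightarrow> 'c) \<Rightarrow> ('a, 'b::euclidean_space) chart \<Rightarrow> ('c, 'd::euclidean_space) chart \<Rightarrow> 'b \<Rightarrow> 'b \<Rightarrow> 'd" where
  "tangent_rep f c d x = frechet_derivative (local_rep f c d) (at x)"

definition pullback1 ::
  "('a \<Rightarrow> 'c) \<Rightarrow> ('a, 'b::euclidean_space) chart \<Rightarrow> ('c, 'd::euclidean_space) chart \<Rightarrow>
   ('c, 'd) form1 \<Rightarrow> 'b \<Rightarrow> 'b \<Rightarrow> real" where
  "pullback1 f c d \<alpha> x v = \<alpha> d (local_rep f c d x) (tangent_rep f c d x v)"

definition one_form :: "('a, 'b::euclidean_space) chart set \<Rightarrow> ('a, 'b) form1 \<Rightarrow> bool" where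
  "one_form A \<alpha> \<longleftrightarrow>
     (\<forall>c\<in>A. (\<forall>x\<in>snd c ` fst c. linear (\<alpha> c x)) \<and> (\<forall>v. smooth_on (snd c ` fst c) (\<lambda>x. \<alpha> c x v))) \<and>
     (\<forall>c\<in>A. \<forall>d\<in>A. \<forall>x\<in>snd c ` (fst c \<inter> fst d). \<forall>v. \<alpha> c x v = pullback1 id c d \<alpha> x v)"

definition vector_field :: "('a, 'b::euclidean_space) chart set \<Rightarrow> ('a, 'b) vfield \<Rightarrow> bool" where
  "vector_field A X \<longleftrightarrow>
     (\<forall>c\<in>A. smooth_on (snd c ` fst c) (X c)) \<and>
     (\<forall>c\<in>A. \<forall>d\<in>A. \<forall>x\<in>snd c ` (fst c \<inter> fst d).
        X d (local_rep id c d x) = tangent_rep id c d x (X c x))"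

definition left_invariant_form ::
  "('a, 'b::euclidean_space) chart set \<Rightarrow> 'a monoid \<Rightarrow> ('a, 'b) form1 \<Rightarrow> bool" where
  "left_invariant_form A G \<alpha> \<longleftrightarrow>
     (\<forall>a. \<forall>c\<in>A. \<forall>d\<in>A. \<forall>x\<in>snd c ` (fst c \<inter> (\<lambda>p. a \<otimes>\<^bsub>G\<^esub> p) -` fst d). \<forall>v.
        pullback1 (\<lambda>p. a \<otimes>\<^bsub>G\<^esub> p) c d \<alpha> x v = \<alpha> c x v)"

definition left_invariant_vfield ::
  "('a, 'b::euclidean_space) chart set \<Rightarrow> 'a monoid \<Rightarrow> ('a, 'b) vfield \<Rightarrow> bool" where
  "left_invariant_vfield A G X \<longleftrightarrow>
     (\<forall>a. \<forall>c\<in>A. \<forall>d\<in>A. \<forall>x\<in>snd c ` (fst c \<inter> (\<lambda>p. a \<otimes>\<^bsub>G\<^esub> p) -` fst d).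
        X d (local_rep (\<lambda>p. a \<otimes>\<^bsub>G\<^esub> p) c d x) = tangent_rep (\<lambda>p. a \<otimes>\<^bsub>G\<^esub> p) c d x (X c x))"

text \<open>Conventions: \<open>(\<alpha> \<and> \<beta>)(u,v) = \<alpha>(u)\<beta>(v) - \<alpha>(v)\<beta>(u)\<close> and
  \<open>d\<alpha>(X,Y) = X(\<alpha>(Y)) - Y(\<alpha>(X)) - \<alpha>([X,Y])\<close>, without factors 1/2.  They are forced by
  \<open>d\<eta>\<^sub>r = 2\<omega>\<^sub>r\<close> on \<open>H\<close> and \<open>\<omega>\<^sub>1 = e\<^sup>1\<^sup>2 + e\<^sup>3\<^sup>4\<close> for orthonormal \<open>e\<^sup>i\<close>.\<close>

definition wedge :: "('a, 'b) form1 \<Rightarrow> ('a, 'b) form1 \<Rightarrow> ('a, 'b) form2" where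
  "wedge \<alpha> \<beta> c x u v = \<alpha> c x u * \<beta> c x v - \<alpha> c x v * \<beta> c x u"

definition ext_deriv :: "('a, 'b::euclidean_space) form1 \<Rightarrow> ('a, 'b) form2" where
  "ext_deriv \<alpha> c x u v =
     frechet_derivative (\<lambda>y. \<alpha> c y v) (at x) u - frechet_derivative (\<lambda>y. \<alpha> c y u) (at x) v"


section \<open>Quaternionic contact structures\<close>

definition triple :: "'x \<Rightarrow> 'x \<Rightarrow> 'x \<Rightarrow> 3 \<Rightarrow> 'x" where
  "triple a b c r = (if r = 1 then a else if r = 2 then b else c)"

text \<open>A smooth Riemannian metric on the distribution \<open>H\<close>; only its values on \<open>H\<close> matter.\<close>

definition metric_on_distribution ::
  "('a, 'b::euclidean_space) chart set \<Rightarrow> ('a, 'b) distribution \<Rightarrow> ('a, 'b) form2 \<Rightarrow> bool" where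
  "metric_on_distribution A H g \<longleftrightarrow>
     (\<forall>c\<in>A. \<forall>x\<in>snd c ` fst c.
        (\<forall>u\<in>H c x. \<forall>v\<in>H c x. \<forall>w\<in>H c x. \<forall>a b.
           g c x (a *\<^sub>R u + b *\<^sub>R v) w = a * g c x u w + b * g c x v w) \<and>
        (\<forall>u\<in>H c x. \<forall>v\<in>H c x. g c x u v = g c x v u) \<and>
        (\<forall>u\<in>H c x. u \<noteq> 0 \<longrightarrow> 0 < g c x u u)) \<and>
     (\<forall>c\<in>A. \<forall>X Y. smooth_on (snd c ` fst c) X \<and> smooth_on (snd c ` fst c) Y \<and>
        (\<forall>x\<in>snd c ` fst c. X x \<in> H c x \<and> Y x \<in> H c x) \<longrightarrow>
        smooth_on (snd c ` fst c) (\<lambda>x. g c x (X x) (Y x))) \<and>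
     (\<forall>c\<in>A. \<forall>d\<in>A. \<forall>x\<in>snd c ` (fst c \<inter> fst d). \<forall>u\<in>H c x. \<forall>v\<in>H c x.
        g c x u v = g d (local_rep id c d x) (tangent_rep id c d x u) (tangent_rep id c d x v))"

definition endo_of_distribution ::
  "('a, 'b::euclidean_space) chart set \<Rightarrow> ('a, 'b) distribution \<Rightarrow> ('a, 'b) endo \<Rightarrow> bool" where
  "endo_of_distribution A H J \<longleftrightarrow>
     (\<forall>c\<in>A. \<forall>x\<in>snd c ` fst c. \<forall>u\<in>H c x. \<forall>v\<in>H c x. \<forall>a b.
        J c x u \<in> H c x \<and> J c x (a *\<^sub>R u + b *\<^sub>R v) = a *\<^sub>R J c x u + b *\<^sub>R J c x v) \<and>
     (\<forall>c\<in>A. \<forall>X. smooth_on (snd c ` fst c) X \<and> (\<forall>x\<in>snd c ` fst c. X x \<in> H c x) \<longrightarrow>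
        smooth_on (snd c ` fst c) (\<lambda>x. J c x (X x))) \<and>
     (\<forall>c\<in>A. \<forall>d\<in>A. \<forall>x\<in>snd c ` (fst c \<inter> fst d). \<forall>u\<in>H c x.
        tangent_rep id c d x (J c x u) = J d (local_rep id c d x) (tangent_rep id c d x u))"

text \<open>The contact forms and almost complex structures, in general only local, are here globally
  defined.  Smoothness of \<open>H\<close> and its compatibility with change of charts follow from
  \<open>H\<close> being the common kernel of the \<open>\<eta>\<^sub>r\<close>.\<close>

definition qc_structure ::
  "('a, 'b::euclidean_space) chart set \<Rightarrow> ('a, 'b) distribution \<Rightarrow> ('a, 'b) form2 \<Rightarrow>
   (3 \<Rightarrow> ('a, 'b) form1) \<Rightarrow> (3 \<Rightarrow> ('a, 'b) endo) \<Rightarrow> bool" where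
  "qc_structure A H g \<eta> I \<longleftrightarrow>
     DIM('b) = 7 \<and>
     (\<forall>r. one_form A (\<eta> r)) \<and> metric_on_distribution A H g \<and>
     (\<forall>r. endo_of_distribution A H (I r)) \<and>
     (\<forall>c\<in>A. \<forall>x\<in>snd c ` fst c.
        subspace (H c x) \<and> dim (H c x) = 4 \<and> H c x = {v. \<forall>r. \<eta> r c x v = 0} \<and>
        (\<forall>u\<in>H c x.
           (\<forall>r. I r c x (I r c x u) = - u) \<and>
           I 1 c x (I 2 c x u) = I 3 c x u \<and> I 2 c x (I 1 c x u) = - I 3 c x u) \<and>
        (\<forall>u\<in>H c x. \<forall>v\<in>H c x. \<forall>r.
           g c x (I r c x u) (I r c x v) = g c x u v \<and>
           2 * g c x (I r c x u) v = ext_deriv (\<eta> r) c x u v))"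

text \<open>Integrability in dimension 7 in the sense of Duchemin: existence of Reeb vector fields.\<close>

definition qc_integrable ::
  "('a, 'b::euclidean_space) chart set \<Rightarrow> ('a, 'b) distribution \<Rightarrow> (3 \<Rightarrow> ('a, 'b) form1) \<Rightarrow> bool" where
  "qc_integrable A H \<eta> \<longleftrightarrow> (\<exists>\<xi> :: 3 \<Rightarrow> ('a, 'b) vfield.
     (\<forall>r. vector_field A (\<xi> r)) \<and>
     (\<forall>c\<in>A. \<forall>x\<in>snd c ` fst c. \<forall>r s.
        \<eta> s c x (\<xi> r c x) = (if r = s then 1 else 0) \<and>
        (\<forall>u\<in>H c x.
           ext_deriv (\<eta> s) c x (\<xi> s c x) u = 0 \<and>
           ext_deriv (\<eta> s) c x (\<xi> r c x) u = - ext_deriv (\<eta> r) c x (\<xi> s c x) u)))"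


section \<open>The quaternionic Heisenberg group and local qc conformal flatness\<close>

text \<open>\<open>\<real>\<^sup>4\<close> is identified with the quaternions by \<open>q = q\<^sub>1 + q\<^sub>2 i + q\<^sub>3 j + q\<^sub>4 k\<close>.
  Then \<open>Im (p * cnj q)\<close> has the components \<open>- heis_omega r p q\<close>.\<close>

type_synonym heis = "(real^4) \<times> (real^3)"

definition heis_omega :: "3 \<Rightarrow> real^4 \<Rightarrow> real^4 \<Rightarrow> real" where
  "heis_omega r p q = (let w = (\<lambda>i j. p$i * q$j - p$j * q$i) in
     triple (w 1 2 + w 3 4) (w 1 3 + w 4 2) (w 1 4 + w 2 3) r)"

definition heis_mult :: "heis \<Rightarrow> heis \<Rightarrow> heis" where
  "heis_mult a b = (fst a + fst b, snd a + snd b + 2 *\<^sub>R (\<chi> r. - heis_omega r (fst a) (fst b)))"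

text \<open>The forms \<open>\<theta>\<^sup>5\<close>, \<open>\<theta>\<^sup>6\<close>, \<open>\<theta>\<^sup>7\<close>, i.e. \<open>(dw - q d(cnj q) + dq cnj q) / 2\<close>;
  \<open>\<theta>\<^sup>1, \<dots>, \<theta>\<^sup>4\<close> are the differentials of the components of \<open>q\<close>.\<close>

definition heis_contact :: "3 \<Rightarrow> (heis, heis) form1" where
  "heis_contact r c x v = snd v $ r / 2 + heis_omega r (fst x) (fst v)"

lemma heis_mult_group: "group \<lparr>carrier = UNIV, mult = heis_mult, one = 0\<rparr>"
proof (rule groupI)
  fix x :: heis
  show "\<exists>y\<in>carrier \<lparr>carrier = UNIV, mult = heis_mult, one = 0\<rparr>.
      y \<otimes>\<^bsub>\<lparr>carrier = UNIV, mult = heis_mult, one = 0\<rparr>\<^esub> x = \<one>\<^bsub>\<lparr>carrier = UNIV, mult = heis_mult, one = 0\<rparr>\<^esub>"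
    by (intro bexI[of _ "- x"])
       (auto simp: heis_mult_def heis_omega_def triple_def vec_eq_iff prod_eq_iff Let_def)
qed (auto simp: heis_mult_def heis_omega_def triple_def vec_eq_iff prod_eq_iff Let_def algebra_simps)

lemma heis_contact_left_invariant:
  "left_invariant_form {std_chart} \<lparr>carrier = UNIV, mult = heis_mult, one = 0\<rparr> (heis_contact r)"
proof -
  have lin: "linear (\<lambda>b. 2 *\<^sub>R (\<chi> r. - heis_omega r (fst (a::heis)) (fst (b::heis))))" for a
    by (rule linearI)
       (auto simp: heis_omega_def triple_def vec_eq_iff Let_def algebra_simps)
  have "(heis_mult a has_derivative
      (\<lambda>v. (fst v, snd v + 2 *\<^sub>R (\<chi> r. - heis_omega r (fst a) (fst v))))) (at x)" for a x
    unfolding heis_mult_def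
    by (rule derivative_eq_intros linear_imp_has_derivative[OF lin] refl | simp)+
  then have fd: "frechet_derivative (heis_mult a) (at x) =
      (\<lambda>v. (fst v, snd v + 2 *\<^sub>R (\<chi> r. - heis_omega r (fst a) (fst v))))" for a x
    by (rule frechet_derivative_at[symmetric])
  have "local_rep (heis_mult a) std_chart std_chart = heis_mult a" for a
    by (simp add: local_rep_def chart_inv_def inv_id)
  then have "pullback1 (heis_mult a) std_chart std_chart (heis_contact r) x v =
      heis_contact r std_chart x v" for a x v
    by (simp add: pullback1_def tangent_rep_def fd heis_contact_def heis_mult_def heis_omega_def
        triple_def Let_def field_simps)
  then show ?thesis
    by (simp add: left_invariant_form_def)
qed

lemma ext_deriv_heis_contact:
  "ext_deriv (heis_contact r) c x u v = 2 * heis_omega r (fst u) (fst v)"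
proof -
  have lin: "linear (\<lambda>y. heis_omega r (fst (y::heis)) (fst (w::heis)))" for w
    by (rule linearI) (auto simp: heis_omega_def triple_def Let_def algebra_simps)
  have "((\<lambda>y. heis_contact r c y w) has_derivative (\<lambda>y. heis_omega r (fst y) (fst w))) (at x)" for w
    unfolding heis_contact_def
    by (rule derivative_eq_intros linear_imp_has_derivative[OF lin] refl | simp)+
  then have "frechet_derivative (\<lambda>y. heis_contact r c y w) (at x) = (\<lambda>y. heis_omega r (fst y) (fst w))" for w
    by (rule frechet_derivative_at[symmetric])
  then show ?thesis
    by (auto simp: ext_deriv_def heis_omega_def triple_def Let_def)
qed

definition locally_qc_conformally_flat ::
  "('a::topological_space, 'b::euclidean_space) chart set \<Rightarrow> (3 \<Rightarrow> ('a, 'b) form1) \<Rightarrow> bool" where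
  "locally_qc_conformally_flat A \<eta> \<longleftrightarrow>
     (\<forall>p. \<exists>U (F :: 'a \<Rightarrow> heis) (\<nu> :: 'a \<Rightarrow> real) (\<Psi> :: 'a \<Rightarrow> real^3^3).
        p \<in> U \<and> diffeomorphism_onto_open A {std_chart} U F \<and>
        smooth_function_on A U \<nu> \<and> (\<forall>q\<in>U. 0 < \<nu> q) \<and>
        smooth_function_on A U \<Psi> \<and> (\<forall>q\<in>U. rotation_matrix (\<Psi> q)) \<and>
        (\<forall>c\<in>A. \<forall>q\<in>fst c \<inter> U. \<forall>v r.
           pullback1 F c std_chart (heis_contact r) (snd c q) v =
             \<nu> q * (\<Sum>s\<in>UNIV. \<Psi> q $ r $ s * \<eta> s c (snd c q) v)))"


section \<open>The structure equations\<close>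

definition G2_structure_equations ::
  "('a, 'b::euclidean_space) chart set \<Rightarrow> (nat \<Rightarrow> ('a, 'b) form1) \<Rightarrow> bool" where
  "G2_structure_equations A e \<longleftrightarrow>
     (\<forall>c\<in>A. \<forall>x\<in>snd c ` fst c. \<forall>u v.
        let de = (\<lambda>i. ext_deriv (e i) c x u v); w = (\<lambda>i j. wedge (e i) (e j) c x u v) in
        de 1 = 0 \<and>
        de 2 = 2/3 * w 1 2 + 1/6 * w 1 5 - 1/3 * w 3 4 + 1/6 * w 4 6 \<and>
        de 3 = - (2/3) * w 1 3 + 1/6 * w 1 6 - w 2 4 - 1/6 * w 4 5 \<and>
        de 4 = - (2/3) * w 1 4 \<and>
        de 5 = 2 * (w 1 2 + w 3 4) - w 4 6 \<and>
        de 6 = 2 * (w 1 3 + w 4 2) + w 4 5 \<and>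
        de 7 = 2 * (w 1 4 + w 2 3) - 1/6 * w 5 6)"

definition fundamental_forms :: "(nat \<Rightarrow> ('a, 'b) form1) \<Rightarrow> 3 \<Rightarrow> ('a, 'b) form2" where
  "fundamental_forms e r c x u v = (let w = (\<lambda>i j. wedge (e i) (e j) c x u v) in
     triple (w 1 2 + w 3 4) (w 1 3 + w 4 2) (w 1 4 + w 2 3) r)"

end

theory Submission
  imports Defs
begin

text \<open>
  The statement about flatness reduces to a statement about one \<open>\<real>\<^sup>4\<close>-valued function.  Suppose that
  \<open>F = (q, w)\<close> maps a neighbourhood to the Heisenberg group and pulls the flat contact forms back to
  \<open>\<nu> \<Psi> \<eta>\<close>, and write \<open>D\<^sub>i\<close> for the derivative along the vector field \<open>E\<^sub>i\<close> and \<open>Q\<^sub>i = D\<^sub>i q\<close>.  The pulled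
  back forms vanish on \<open>H\<close>; differentiating this once more along \<open>H\<close> expresses that the matrix with the
  columns \<open>Q\<^sub>1, \<dots>, Q\<^sub>4\<close> carries the quaternionic forms \<open>\<omega>\<^sub>r\<close> to \<open>\<nu> \<Psi> \<omega>\<close>.  By Lagrange's identity for
  quaternions such a matrix is conformal: \<open>Q\<^sub>i \<bullet> Q\<^sub>j = \<nu> \<delta>\<^sub>i\<^sub>j\<close> (lemma \<open>quaternionic_frame_conformal\<close>).

  Expanding \<open>D\<^sub>i Q\<^sub>j\<close> in the frame \<open>Q\<close> gives functions \<open>\<Gamma>\<^sub>i\<^sub>j\<^sub>k\<close>, the coefficients of a partial connection
  which is flat because it comes from the constant vectors of \<open>\<real>\<^sup>4\<close>.  The forms \<open>\<omega>\<^sub>r\<close> vanish on the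
  anti-self-dual bivectors of \<open>H\<close>, so the corresponding combinations of brackets are again horizontal;
  from the structure equations they are
  \<open>[E\<^sub>1,E\<^sub>2] - [E\<^sub>3,E\<^sub>4] = - E\<^sub>2\<close>, \<open>[E\<^sub>1,E\<^sub>3] - [E\<^sub>4,E\<^sub>2] = 5/3 E\<^sub>3\<close>, \<open>[E\<^sub>1,E\<^sub>4] - [E\<^sub>2,E\<^sub>3] = 2/3 E\<^sub>4\<close>.
  Applied to \<open>q\<close> they determine the anti-self-dual part of \<open>\<Gamma>\<close> up to four unknown functions (which reflect
  the freedom of a conformal change), and applied to \<open>Q\<^sub>l\<close> they state the vanishing of the curvature on
  anti-self-dual bivectors.  In the trace-free symmetric part of this curvature, which corresponds to the
  qc conformal curvature tensor, the unknown functions and their derivatives cancel.  What remains is a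
  constant, and it is not zero; this is lemma \<open>no_G2_brackets\<close>.

  The structure itself is given by \<open>I\<^sub>r u = \<Sum>\<^sub>j \<omega>\<^sub>r(u, E\<^sub>j) E\<^sub>j\<close>, and its Reeb vector fields are
  \<open>E\<^sub>5\<close>, \<open>E\<^sub>6\<close>, \<open>E\<^sub>7\<close>.
\<close>

section \<open>Smooth functions on open sets\<close>

text \<open>On an open set the derivative at a point depends only on the values near that point, so the
  congruence rule survives the induction over the order of differentiation.\<close>

lemma Ck_on_cong:
  assumes "open S" "\<And>x. x \<in> S \<Longrightarrow> f x = g x" "Ck_on k S f"
  shows "Ck_on k S g"
  using assms(2,3)
proof (induction k arbitrary: f g)
  case 0
  then show ?case
    by (auto cong: continuous_on_cong)
next
  case (Suc k)
  have der: "frechet_derivative g (at x) = frechet_derivative f (at x)" "g differentiable (at x)"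
    if "x \<in> S" for x
  proof -
    have "(f has_derivative frechet_derivative f (at x)) (at x)"
      using Suc.prems that by (simp add: frechet_derivative_works)
    then have "(g has_derivative frechet_derivative f (at x)) (at x)"
      by (rule has_derivative_transform_within_open[OF _ assms(1) that Suc.prems(1)])
    then show "frechet_derivative g (at x) = frechet_derivative f (at x)" "g differentiable (at x)"
      using frechet_derivative_at by (force, auto simp: differentiable_def)
  qed
  have "Ck_on k S (\<lambda>x. frechet_derivative g (at x) v)" for v
  proof (rule Suc.IH)
    show "Ck_on k S (\<lambda>x. frechet_derivative f (at x) v)"
      using Suc.prems(2) by simp
  qed (simp add: der(1))
  then show ?case
    using der(2) by simp
qed

lemma Ck_on_differentiable: "Ck_on (Suc k) S f \<Longrightarrow> x \<in> S \<Longrightarrow> f differentiable (at x)"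
  by simp

lemma Ck_on_subset: "Ck_on k S f \<Longrightarrow> T \<subseteq> S \<Longrightarrow> Ck_on k T f"
  by (induction k arbitrary: f) (auto intro: continuous_on_subset)

lemma Ck_on_Suc_D: "Ck_on (Suc k) S f \<Longrightarrow> Ck_on k S f"
proof (induction k arbitrary: f)
  case 0
  then show ?case
    by (auto intro!: continuous_at_imp_continuous_on differentiable_imp_continuous_within)
next
  case (Suc k)
  then show ?case
    by (metis Ck_on.simps(2))
qed

lemma Ck_on_const [simp]: "Ck_on k S (\<lambda>x. c)"
  by (induction k arbitrary: c) auto

lemma Ck_on_add:
  assumes "open S" "Ck_on k S f" "Ck_on k S g"
  shows "Ck_on k S (\<lambda>x. f x + g x)"
  using assms(2,3)
proof (induction k arbitrary: f g)
  case 0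
  then show ?case by (auto intro: continuous_intros)
next
  case (Suc k)
  have der: "((\<lambda>x. f x + g x) has_derivative
      (\<lambda>v. frechet_derivative f (at x) v + frechet_derivative g (at x) v)) (at x)" if "x \<in> S" for x
    using Suc.prems that by (intro has_derivative_add) (auto simp: frechet_derivative_works[symmetric])
  have "Ck_on k S (\<lambda>x. frechet_derivative (\<lambda>x. f x + g x) (at x) v)" for v
  proof (rule Ck_on_cong[OF assms(1)])
    show "Ck_on k S (\<lambda>x. frechet_derivative f (at x) v + frechet_derivative g (at x) v)"
      using Suc.prems by (intro Suc.IH) auto
  qed (simp add: frechet_derivative_at[OF der, symmetric])
  then show ?case
    using der by (auto simp: differentiable_def)
qed

text \<open>By the product rule the derivative of a product is a sum of two products of functions that
  are differentiable one time less, which closes the induction.\<close>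

lemma Ck_on_bilinear:
  assumes "bounded_bilinear prd" "open S" "Ck_on k S f" "Ck_on k S g"
  shows "Ck_on k S (\<lambda>x. prd (f x) (g x))"
  using assms(3,4)
proof (induction k arbitrary: f g)
  case 0
  then show ?case by (auto intro: bounded_bilinear.continuous_on[OF assms(1)])
next
  case (Suc k)
  have der: "((\<lambda>x. prd (f x) (g x)) has_derivative
      (\<lambda>v. prd (f x) (frechet_derivative g (at x) v) + prd (frechet_derivative f (at x) v) (g x))) (at x)"
    if "x \<in> S" for x
    using Suc.prems that
    by (intro bounded_bilinear.FDERIV[OF assms(1)]) (auto simp: frechet_derivative_works[symmetric])
  have "Ck_on k S (\<lambda>x. prd (f x) (frechet_derivative g (at x) v) + prd (frechet_derivative f (at x) v) (g x))" for v
    using Suc.prems Ck_on_Suc_D[OF Suc.prems(1)] Ck_on_Suc_D[OF Suc.prems(2)]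
    by (intro Ck_on_add assms(2) Suc.IH) auto
  then have "Ck_on k S (\<lambda>x. frechet_derivative (\<lambda>x. prd (f x) (g x)) (at x) v)" for v
    by (rule Ck_on_cong[OF assms(2), rotated]) (simp add: frechet_derivative_at[OF der, symmetric])
  then show ?case
    using der by (auto simp: differentiable_def)
qed

lemma smooth_on_cong:
  "open S \<Longrightarrow> (\<And>x. x \<in> S \<Longrightarrow> f x = g x) \<Longrightarrow> smooth_on S f \<Longrightarrow> smooth_on S g"
  unfolding smooth_on_def using Ck_on_cong by blast

lemma smooth_on_subset: "smooth_on S f \<Longrightarrow> T \<subseteq> S \<Longrightarrow> smooth_on T f"
  unfolding smooth_on_def using Ck_on_subset by blast

lemma smooth_on_const [simp]: "smooth_on S (\<lambda>x. c)"
  by (simp add: smooth_on_def)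

lemma smooth_on_add: "open S \<Longrightarrow> smooth_on S f \<Longrightarrow> smooth_on S g \<Longrightarrow> smooth_on S (\<lambda>x. f x + g x)"
  by (simp add: smooth_on_def Ck_on_add)

lemma smooth_on_bilinear:
  "bounded_bilinear prd \<Longrightarrow> open S \<Longrightarrow> smooth_on S f \<Longrightarrow> smooth_on S g \<Longrightarrow>
    smooth_on S (\<lambda>x. prd (f x) (g x))"
  by (simp add: smooth_on_def Ck_on_bilinear)

lemmas smooth_on_mult = smooth_on_bilinear[OF bounded_bilinear_mult]
lemmas smooth_on_scaleR = smooth_on_bilinear[OF bounded_bilinear_scaleR]
lemmas smooth_on_inner = smooth_on_bilinear[OF bounded_bilinear_inner]

lemma smooth_on_bounded_linear:
  assumes "bounded_linear h" "open S" "smooth_on S f"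
  shows "smooth_on S (\<lambda>x. h (f x))"
proof -
  interpret bounded_linear h by fact
  have "bounded_bilinear (\<lambda>(a::real) x. a *\<^sub>R h x)"
    by (rule bounded_bilinear.comp[OF bounded_bilinear_scaleR bounded_linear_ident assms(1)])
  then have "smooth_on S (\<lambda>x. 1 *\<^sub>R h (f x))"
    using assms by (intro smooth_on_bilinear[where prd="\<lambda>(a::real) x. a *\<^sub>R h x"]) auto
  then show ?thesis by simp
qed

lemma smooth_on_minus: "open S \<Longrightarrow> smooth_on S f \<Longrightarrow> smooth_on S (\<lambda>x. - f x)"
  by (rule smooth_on_bounded_linear[OF bounded_linear_minus[OF bounded_linear_ident]])

lemma smooth_on_diff: "open S \<Longrightarrow> smooth_on S f \<Longrightarrow> smooth_on S g \<Longrightarrow> smooth_on S (\<lambda>x. f x - g x)"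
  using smooth_on_add[of S f "\<lambda>x. - g x"] smooth_on_minus[of S g] by simp

lemma smooth_on_sum:
  "open S \<Longrightarrow> (\<And>i. i \<in> J \<Longrightarrow> smooth_on S (f i)) \<Longrightarrow> smooth_on S (\<lambda>x. \<Sum>i\<in>J. f i x)"
  by (induction J rule: infinite_finite_induct) (auto intro: smooth_on_add)

lemma smooth_on_differentiable: "smooth_on S f \<Longrightarrow> x \<in> S \<Longrightarrow> f differentiable (at x)"
  unfolding smooth_on_def using Ck_on_differentiable by blast

lemma smooth_on_has_derivative:
  "smooth_on S f \<Longrightarrow> x \<in> S \<Longrightarrow> (f has_derivative frechet_derivative f (at x)) (at x)"
  by (simp add: smooth_on_differentiable frechet_derivative_works[symmetric])

lemma smooth_on_frechet_derivative:
  "smooth_on S f \<Longrightarrow> smooth_on S (\<lambda>x. frechet_derivative f (at x) v)"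
  unfolding smooth_on_def by (metis Ck_on.simps(2))

text \<open>Linear forms depending smoothly on the point may be applied to a varying vector: expand the
  vector in the standard basis.\<close>

lemma smooth_on_linear_apply:
  fixes X :: "'a::real_normed_vector \<Rightarrow> 'b::euclidean_space"
  assumes "open S" "\<And>x. x \<in> S \<Longrightarrow> linear (\<alpha> x)" "\<And>v. smooth_on S (\<lambda>x. \<alpha> x v)" "smooth_on S X"
  shows "smooth_on S (\<lambda>x. \<alpha> x (X x))"
proof (rule smooth_on_cong[OF assms(1)])
  show "smooth_on S (\<lambda>x. \<Sum>b\<in>Basis. (X x \<bullet> b) *\<^sub>R \<alpha> x b)"
    using assms by (intro smooth_on_sum smooth_on_scaleR smooth_on_inner) auto
  show "(\<Sum>b\<in>Basis. (X x \<bullet> b) *\<^sub>R \<alpha> x b) = \<alpha> x (X x)" if "x \<in> S" for x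
  proof -
    have "\<alpha> x (X x) = \<alpha> x (\<Sum>b\<in>Basis. (X x \<bullet> b) *\<^sub>R b)"
      by (simp add: euclidean_representation)
    also have "\<dots> = (\<Sum>b\<in>Basis. (X x \<bullet> b) *\<^sub>R \<alpha> x b)"
      using assms(2)[OF that] by (simp add: linear_sum linear_cmul)
    finally show ?thesis by simp
  qed
qed

section \<open>Derivatives along vector fields and their commutators\<close>

definition along :: "('b::real_normed_vector \<Rightarrow> 'b) \<Rightarrow> ('b \<Rightarrow> 'c::real_normed_vector) \<Rightarrow> 'b \<Rightarrow> 'c" where
  "along X f x = frechet_derivative f (at x) (X x)"

lemma along_eq: "(f has_derivative f') (at x) \<Longrightarrow> along X f x = f' (X x)"
  by (simp add: along_def frechet_derivative_at[symmetric])

lemma smooth_on_along: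
  fixes X :: "'b::euclidean_space \<Rightarrow> 'b"
  assumes "open S" "smooth_on S X" "smooth_on S f"
  shows "smooth_on S (along X f)"
  unfolding along_def
proof (rule smooth_on_linear_apply[OF assms(1) _ _ assms(2)])
  show "linear (frechet_derivative f (at x))" if "x \<in> S" for x
    using smooth_on_has_derivative[OF assms(3) that] by (rule has_derivative_linear)
qed (rule smooth_on_frechet_derivative[OF assms(3)])

lemma along_cong:
  assumes "open S" "x \<in> S" "\<And>y. y \<in> S \<Longrightarrow> f y = g y" "f differentiable (at x)"
  shows "along X f x = along X g x"
  using frechet_derivative_transform_within_open[OF assms(4,1,2,3)] by (simp add: along_def)

lemma along_const_on:
  assumes "open S" "x \<in> S" "\<And>y. y \<in> S \<Longrightarrow> f y = c"
  shows "along X f x = 0"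
proof -
  have "(f has_derivative (\<lambda>_. 0)) (at x)"
    by (rule has_derivative_transform_within_open[OF has_derivative_const assms(1,2)]) (simp add: assms(3))
  then show ?thesis
    by (rule along_eq)
qed

lemma along_bilinear:
  assumes "bounded_bilinear prd" "f differentiable (at x)" "g differentiable (at x)"
  shows "along X (\<lambda>y. prd (f y) (g y)) x = prd (f x) (along X g x) + prd (along X f x) (g x)"
  using assms
  by (subst along_eq[OF bounded_bilinear.FDERIV]) (auto simp: along_def frechet_derivative_works[symmetric])

lemmas along_inner = along_bilinear[OF bounded_bilinear_inner]

lemma along_bounded_linear:
  assumes "bounded_linear h" "f differentiable (at x)"
  shows "along X (\<lambda>y. h (f y)) x = h (along X f x)"
  using assms
  by (subst along_eq[OF bounded_linear.has_derivative]) (auto simp: along_def frechet_derivative_works[symmetric])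

lemma along_add:
  assumes "f differentiable (at x)" "g differentiable (at x)"
  shows "along X (\<lambda>y. f y + g y) x = along X f x + along X g x"
  using assms
  by (subst along_eq[OF has_derivative_add]) (auto simp: along_def frechet_derivative_works[symmetric])

lemma along_diff:
  assumes "f differentiable (at x)" "g differentiable (at x)"
  shows "along X (\<lambda>y. f y - g y) x = along X f x - along X g x"
  using assms
  by (subst along_eq[OF has_derivative_diff]) (auto simp: along_def frechet_derivative_works[symmetric])

lemma along_divide:
  fixes f g :: "'b::real_normed_vector \<Rightarrow> real"
  assumes "f differentiable (at x)" "g differentiable (at x)" "g x \<noteq> 0"
  shows "along X (\<lambda>y. f y / g y) x = along X f x / g x - f x * along X g x / (g x)\<^sup>2"
proof -
  have df: "(f has_derivative frechet_derivative f (at x)) (at x)"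
    "(g has_derivative frechet_derivative g (at x)) (at x)"
    using assms by (auto simp: frechet_derivative_works[symmetric])
  show ?thesis
    using along_eq[OF has_derivative_divide'[OF df assms(3)], of X] assms(3)
    by (simp add: along_def field_simps power2_eq_square)
qed

text \<open>Symmetry of second derivatives: the second difference over a small parallelogram spanned by \<open>u\<close>
  and \<open>v\<close> does not change when \<open>u\<close> and \<open>v\<close> are exchanged, and two applications of the mean value theorem
  turn it into a mixed second derivative at some point of the parallelogram.\<close>

lemma second_difference_mean_value:
  fixes f :: "'b::real_normed_vector \<Rightarrow> real"
  assumes "Ck_on 2 S f" "h > 0"
    and S: "\<And>s t. 0 \<le> s \<Longrightarrow> s \<le> h \<Longrightarrow> 0 \<le> t \<Longrightarrow> t \<le> h \<Longrightarrow> x + s *\<^sub>R u + t *\<^sub>R v \<in> S"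
  obtains s t where "0 \<le> s" "s \<le> h" "0 \<le> t" "t \<le> h"
    "f (x + h *\<^sub>R u + h *\<^sub>R v) - f (x + h *\<^sub>R u) - f (x + h *\<^sub>R v) + f x =
      h\<^sup>2 * frechet_derivative (\<lambda>y. frechet_derivative f (at y) u) (at (x + s *\<^sub>R u + t *\<^sub>R v)) v"
proof -
  define fu where "fu y = frechet_derivative f (at y) u" for y
  define fuv where "fuv y = frechet_derivative fu (at y) v" for y
  have df: "(f has_derivative frechet_derivative f (at y)) (at y)" if "y \<in> S" for y
    using assms(1) that by (simp add: numeral_2_eq_2 frechet_derivative_works[symmetric])
  have dfu: "(fu has_derivative frechet_derivative fu (at y)) (at y)" if "y \<in> S" for y
    using assms(1) that by (simp add: numeral_2_eq_2 frechet_derivative_works[symmetric] fu_def[abs_def])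
  define G where "G s = f (x + s *\<^sub>R u + h *\<^sub>R v) - f (x + s *\<^sub>R u)" for s
  have curve: "((\<lambda>s. f (x + s *\<^sub>R u + t *\<^sub>R v)) has_real_derivative fu (x + s *\<^sub>R u + t *\<^sub>R v)) (at s)"
    if "0 \<le> s" "s \<le> h" "0 \<le> t" "t \<le> h" for s t
  proof -
    have "((\<lambda>s. f (x + s *\<^sub>R u + t *\<^sub>R v)) has_derivative
        (\<lambda>r. frechet_derivative f (at (x + s *\<^sub>R u + t *\<^sub>R v)) (r *\<^sub>R u))) (at s)"
      by (rule has_derivative_compose[where f="\<lambda>s. x + s *\<^sub>R u + t *\<^sub>R v" and g=f])
         (auto intro!: derivative_eq_intros df S that)
    then show ?thesis
      using linear_cmul[OF has_derivative_linear[OF df[OF S[OF that]]]]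
      by (simp add: has_field_derivative_def fu_def mult_commute_abs)
  qed
  have "\<exists>s. 0 < s \<and> s < h \<and> G h - G 0 = (h - 0) * (fu (x + s *\<^sub>R u + h *\<^sub>R v) - fu (x + s *\<^sub>R u))"
  proof (rule MVT2)
    fix s assume "0 \<le> s" "s \<le> h"
    then show "(G has_real_derivative (fu (x + s *\<^sub>R u + h *\<^sub>R v) - fu (x + s *\<^sub>R u))) (at s)"
      using curve[of s h] curve[of s 0] assms(2) unfolding G_def by (auto intro: DERIV_diff)
  qed (use assms in auto)
  then obtain s where s: "0 < s" "s < h"
    "G h - G 0 = h * (fu (x + s *\<^sub>R u + h *\<^sub>R v) - fu (x + s *\<^sub>R u))" by auto
  have "\<exists>t. 0 < t \<and> t < h \<and> fu (x + s *\<^sub>R u + h *\<^sub>R v) - fu (x + s *\<^sub>R u + 0 *\<^sub>R v) =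
      (h - 0) * fuv (x + s *\<^sub>R u + t *\<^sub>R v)"
  proof (rule MVT2)
    fix t assume t: "0 \<le> t" "t \<le> h"
    have st: "x + s *\<^sub>R u + t *\<^sub>R v \<in> S" using s t by (intro S) auto
    have "((\<lambda>t. fu (x + s *\<^sub>R u + t *\<^sub>R v)) has_derivative
        (\<lambda>r. frechet_derivative fu (at (x + s *\<^sub>R u + t *\<^sub>R v)) (r *\<^sub>R v))) (at t)"
      by (rule has_derivative_compose[where f="\<lambda>t. x + s *\<^sub>R u + t *\<^sub>R v" and g=fu])
         (auto intro!: derivative_eq_intros dfu st)
    then show "((\<lambda>t. fu (x + s *\<^sub>R u + t *\<^sub>R v)) has_real_derivative fuv (x + s *\<^sub>R u + t *\<^sub>R v)) (at t)"
      using linear_cmul[OF has_derivative_linear[OF dfu[OF st]]]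
      by (simp add: has_field_derivative_def fuv_def mult_commute_abs)
  qed (use assms in auto)
  then obtain t where t: "0 < t" "t < h"
    "fu (x + s *\<^sub>R u + h *\<^sub>R v) - fu (x + s *\<^sub>R u) = h * fuv (x + s *\<^sub>R u + t *\<^sub>R v)" by auto
  have "f (x + h *\<^sub>R u + h *\<^sub>R v) - f (x + h *\<^sub>R u) - f (x + h *\<^sub>R v) + f x = G h - G 0"
    by (simp add: G_def)
  also have "\<dots> = h\<^sup>2 * fuv (x + s *\<^sub>R u + t *\<^sub>R v)"
    unfolding s(3) t(3) by (simp add: power2_eq_square)
  finally show ?thesis
    using s t by (intro that[of s t]) (auto simp: fuv_def fu_def[abs_def])
qed

lemma frechet_derivative_commute_real:
  fixes f :: "'b::real_normed_vector \<Rightarrow> real"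
  assumes "open S" "Ck_on 2 S f" "x \<in> S"
  shows "frechet_derivative (\<lambda>y. frechet_derivative f (at y) u) (at x) v =
    frechet_derivative (\<lambda>y. frechet_derivative f (at y) v) (at x) u"
proof -
  define F where "F u v y = frechet_derivative (\<lambda>y. frechet_derivative f (at y) u) (at y) v" for u v y
  have cont: "continuous_on S (F u v)" for u v
    using assms(2) by (simp add: F_def numeral_2_eq_2)
  have "\<bar>F u v x - F v u x\<bar> < 2 * \<epsilon>" if "\<epsilon> > 0" for \<epsilon>
  proof -
    have near: "\<forall>\<^sub>F y in nhds x. y \<in> S \<and> \<bar>F u v y - F u v x\<bar> < \<epsilon> \<and> \<bar>F v u y - F v u x\<bar> < \<epsilon>"
    proof -
      have "\<forall>\<^sub>F y in nhds x. \<bar>F u v y - F u v x\<bar> < \<epsilon>" for u v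
      proof -
        have "isCont (F u v) x"
          using cont assms(1,3) by (simp add: continuous_on_eq_continuous_at)
        then have "(F u v \<longlongrightarrow> F u v x) (nhds x)"
          by (simp add: continuous_at tendsto_at_iff_tendsto_nhds)
        then show ?thesis
          using that by (auto dest!: tendstoD simp: dist_real_def)
      qed
      moreover have "\<forall>\<^sub>F y in nhds x. y \<in> S"
        using assms(1,3) by (auto simp: eventually_nhds)
      ultimately show ?thesis by (simp add: eventually_conj_iff)
    qed
    then obtain \<delta> where \<delta>: "\<delta> > 0"
      "\<And>y. dist y x < \<delta> \<Longrightarrow> y \<in> S \<and> \<bar>F u v y - F u v x\<bar> < \<epsilon> \<and> \<bar>F v u y - F v u x\<bar> < \<epsilon>"
      unfolding eventually_nhds_metric by blast
    \<comment> \<open>The parallelogram with sides \<open>h u\<close> and \<open>h v\<close> stays within distance \<open>\<delta>\<close> of \<open>x\<close>.\<close>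
    define h where "h = \<delta> / (norm u + norm v + 1)"
    have pos: "norm u + norm v + 1 > 0" by (smt (verit) norm_ge_zero)
    have h: "h > 0" using \<delta> pos by (simp add: h_def)
    have close: "dist (x + s *\<^sub>R u + t *\<^sub>R v) x < \<delta>" if "0 \<le> s" "s \<le> h" "0 \<le> t" "t \<le> h" for s t
    proof -
      have "dist (x + s *\<^sub>R u + t *\<^sub>R v) x = norm (s *\<^sub>R u + t *\<^sub>R v)"
        by (simp add: dist_norm algebra_simps)
      also have "\<dots> \<le> s * norm u + t * norm v"
        using norm_triangle_ineq[of "s *\<^sub>R u" "t *\<^sub>R v"] that by simp
      also have "\<dots> \<le> h * norm u + h * norm v"
        using that by (intro add_mono mult_right_mono) auto
      also have "\<dots> < h * (norm u + norm v + 1)"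
        using h by (simp add: algebra_simps)
      also have "\<dots> = \<delta>" using pos by (simp add: h_def)
      finally show ?thesis .
    qed
    have closeS: "x + s *\<^sub>R u + t *\<^sub>R v \<in> S" if "0 \<le> s" "s \<le> h" "0 \<le> t" "t \<le> h" for s t
      using \<delta>(2)[OF close[OF that]] by blast
    have closeS': "x + s *\<^sub>R v + t *\<^sub>R u \<in> S" if "0 \<le> s" "s \<le> h" "0 \<le> t" "t \<le> h" for s t
      using closeS[of t s] that by (simp add: add.commute add.left_commute)
    obtain s t where st: "0 \<le> s" "s \<le> h" "0 \<le> t" "t \<le> h"
      "f (x + h *\<^sub>R u + h *\<^sub>R v) - f (x + h *\<^sub>R u) - f (x + h *\<^sub>R v) + f x =
        h\<^sup>2 * F u v (x + s *\<^sub>R u + t *\<^sub>R v)"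
      unfolding F_def by (rule second_difference_mean_value[OF assms(2) h closeS])
    obtain s' t' where st': "0 \<le> s'" "s' \<le> h" "0 \<le> t'" "t' \<le> h"
      "f (x + h *\<^sub>R v + h *\<^sub>R u) - f (x + h *\<^sub>R v) - f (x + h *\<^sub>R u) + f x =
        h\<^sup>2 * F v u (x + s' *\<^sub>R v + t' *\<^sub>R u)"
      unfolding F_def by (rule second_difference_mean_value[OF assms(2) h closeS'])
    have "h\<^sup>2 * F u v (x + s *\<^sub>R u + t *\<^sub>R v) = h\<^sup>2 * F v u (x + s' *\<^sub>R v + t' *\<^sub>R u)"
    proof -
      have "x + h *\<^sub>R v + h *\<^sub>R u = x + h *\<^sub>R u + h *\<^sub>R v" by simp
      with st'(5) have "f (x + h *\<^sub>R u + h *\<^sub>R v) - f (x + h *\<^sub>R v) - f (x + h *\<^sub>R u) + f x =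
          h\<^sup>2 * F v u (x + s' *\<^sub>R v + t' *\<^sub>R u)" by simp
      with st(5) show ?thesis by linarith
    qed
    then have "F u v (x + s *\<^sub>R u + t *\<^sub>R v) = F v u (x + s' *\<^sub>R v + t' *\<^sub>R u)"
      using h by simp
    moreover have "\<bar>F u v (x + s *\<^sub>R u + t *\<^sub>R v) - F u v x\<bar> < \<epsilon>"
      using \<delta>(2)[OF close[OF st(1-4)]] by blast
    moreover have "\<bar>F v u (x + s' *\<^sub>R v + t' *\<^sub>R u) - F v u x\<bar> < \<epsilon>"
      using \<delta>(2)[OF close[OF st'(3,4,1,2)]] by (simp add: add.commute add.left_commute)
    ultimately show ?thesis by linarith
  qed
  from this[of "\<bar>F u v x - F v u x\<bar> / 2"] show ?thesis
    unfolding F_def by fastforce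
qed

lemma frechet_derivative_commute:
  fixes f :: "'b::real_normed_vector \<Rightarrow> 'c::euclidean_space"
  assumes "open S" "smooth_on S f" "x \<in> S"
  shows "frechet_derivative (\<lambda>y. frechet_derivative f (at y) u) (at x) v =
    frechet_derivative (\<lambda>y. frechet_derivative f (at y) v) (at x) u"
proof (rule euclidean_eqI)
  fix b :: 'c assume "b \<in> Basis"
  have inner: "frechet_derivative (\<lambda>y. g y \<bullet> b) (at y) = (\<lambda>v. frechet_derivative g (at y) v \<bullet> b)"
    if "smooth_on S g" "y \<in> S" for g :: "'b \<Rightarrow> 'c" and y
    using smooth_on_has_derivative[OF that]
    by (intro frechet_derivative_at[symmetric] has_derivative_inner_left)
  have comp: "frechet_derivative (\<lambda>y. frechet_derivative f (at y) u) (at x) v \<bullet> b =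
      frechet_derivative (\<lambda>y. frechet_derivative (\<lambda>y. f y \<bullet> b) (at y) u) (at x) v" for u v
  proof -
    have sm: "smooth_on S (\<lambda>y. frechet_derivative f (at y) u)"
      using assms by (simp add: smooth_on_frechet_derivative)
    have "frechet_derivative (\<lambda>y. frechet_derivative f (at y) u \<bullet> b) (at x) =
        frechet_derivative (\<lambda>y. frechet_derivative (\<lambda>y. f y \<bullet> b) (at y) u) (at x)"
    proof (rule frechet_derivative_transform_within_open[OF _ assms(1,3)])
      show "(\<lambda>y. frechet_derivative f (at y) u \<bullet> b) differentiable at x"
        using smooth_on_inner[OF assms(1) sm smooth_on_const] assms(3) smooth_on_differentiable by blast
    qed (simp add: inner[OF assms(2)])
    from fun_cong[OF this, of v] show ?thesis
      by (simp add: inner[OF sm assms(3)])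
  qed
  have "Ck_on 2 S (\<lambda>y. f y \<bullet> b)"
    using smooth_on_inner[OF assms(1,2) smooth_on_const] by (simp add: smooth_on_def)
  from frechet_derivative_commute_real[OF assms(1) this assms(3)]
  show "frechet_derivative (\<lambda>y. frechet_derivative f (at y) u) (at x) v \<bullet> b =
      frechet_derivative (\<lambda>y. frechet_derivative f (at y) v) (at x) u \<bullet> b"
    by (simp only: comp)
qed

text \<open>The product rule for the pairing of a field of linear maps with a vector field.  For a 1-form it
  yields Cartan's formula for the exterior derivative, for the differential of a function the formula
  for commutators.\<close>

lemma along_linear_apply:
  fixes \<alpha> :: "'b::euclidean_space \<Rightarrow> 'a::euclidean_space \<Rightarrow> 'c::real_normed_vector"
  assumes "open S" "\<And>y. y \<in> S \<Longrightarrow> linear (\<alpha> y)" "\<And>v. smooth_on S (\<lambda>y. \<alpha> y v)" "smooth_on S Y" "x \<in> S"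
  shows "along X (\<lambda>y. \<alpha> y (Y y)) x = frechet_derivative (\<lambda>y. \<alpha> y (Y x)) (at x) (X x) + \<alpha> x (along X Y x)"
proof -
  have exp: "\<alpha> y v = (\<Sum>b\<in>Basis. (v \<bullet> b) *\<^sub>R \<alpha> y b)" if "y \<in> S" for y v
  proof -
    have "\<alpha> y v = \<alpha> y (\<Sum>b\<in>Basis. (v \<bullet> b) *\<^sub>R b)"
      by (simp add: euclidean_representation)
    then show ?thesis
      by (simp add: linear_sum[OF assms(2)[OF that]] linear_cmul[OF assms(2)[OF that]])
  qed
  let ?D = "\<lambda>b. frechet_derivative (\<lambda>y. \<alpha> y b) (at x)"
  have dY: "((\<lambda>y. Y y \<bullet> b) has_derivative (\<lambda>v. frechet_derivative Y (at x) v \<bullet> b)) (at x)" for b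
    using smooth_on_has_derivative[OF assms(4,5)] by (rule has_derivative_inner_left)
  have d\<alpha>: "((\<lambda>y. \<alpha> y b) has_derivative ?D b) (at x)" for b
    using smooth_on_has_derivative[OF assms(3,5)] .
  have "((\<lambda>y. \<Sum>b\<in>Basis. (Y y \<bullet> b) *\<^sub>R \<alpha> y b) has_derivative
      (\<lambda>v. \<Sum>b\<in>Basis. (Y x \<bullet> b) *\<^sub>R ?D b v + (frechet_derivative Y (at x) v \<bullet> b) *\<^sub>R \<alpha> x b)) (at x)"
    by (intro has_derivative_sum has_derivative_scaleR dY d\<alpha>)
  then have "((\<lambda>y. \<alpha> y (Y y)) has_derivative
      (\<lambda>v. \<Sum>b\<in>Basis. (Y x \<bullet> b) *\<^sub>R ?D b v + (frechet_derivative Y (at x) v \<bullet> b) *\<^sub>R \<alpha> x b)) (at x)"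
    by (rule has_derivative_transform_within_open[OF _ assms(1,5)]) (metis exp)
  from along_eq[OF this, of X] have "along X (\<lambda>y. \<alpha> y (Y y)) x =
      (\<Sum>b\<in>Basis. (Y x \<bullet> b) *\<^sub>R ?D b (X x)) + (\<Sum>b\<in>Basis. (along X Y x \<bullet> b) *\<^sub>R \<alpha> x b)"
    by (simp add: sum.distrib along_def)
  moreover have "((\<lambda>y. \<Sum>b\<in>Basis. (Y x \<bullet> b) *\<^sub>R \<alpha> y b) has_derivative
      (\<lambda>v. \<Sum>b\<in>Basis. (Y x \<bullet> b) *\<^sub>R ?D b v)) (at x)"
    by (intro has_derivative_sum has_derivative_scaleR_right d\<alpha>)
  then have "((\<lambda>y. \<alpha> y (Y x)) has_derivative (\<lambda>v. \<Sum>b\<in>Basis. (Y x \<bullet> b) *\<^sub>R ?D b v)) (at x)"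
    by (rule has_derivative_transform_within_open[OF _ assms(1,5)]) (metis exp)
  then have "frechet_derivative (\<lambda>y. \<alpha> y (Y x)) (at x) = (\<lambda>v. \<Sum>b\<in>Basis. (Y x \<bullet> b) *\<^sub>R ?D b v)"
    by (rule frechet_derivative_at[symmetric])
  ultimately show ?thesis
    by (simp add: exp[OF assms(5), of "along X Y x", symmetric])
qed

lemma along_bracket:
  fixes f :: "'b::euclidean_space \<Rightarrow> 'c::euclidean_space"
  assumes "open S" "smooth_on S f" "smooth_on S X" "smooth_on S Y" "x \<in> S"
  shows "along X (along Y f) x - along Y (along X f) x =
    frechet_derivative f (at x) (along X Y x - along Y X x)"
proof -
  have lin: "linear (frechet_derivative f (at y))" if "y \<in> S" for y
    using smooth_on_has_derivative[OF assms(2) that] by (rule has_derivative_linear)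
  have along_along: "along X (along Y f) x =
      frechet_derivative (\<lambda>y. frechet_derivative f (at y) (Y x)) (at x) (X x)
        + frechet_derivative f (at x) (along X Y x)" if "smooth_on S Y" for X Y
    unfolding along_def[of Y f, abs_def]
    using assms(1,5) that by (intro along_linear_apply[where S=S] lin smooth_on_frechet_derivative assms(2))
  show ?thesis
    using frechet_derivative_commute[OF assms(1,2,5), of "Y x" "X x"]
    by (simp add: along_along assms(3,4) linear_diff[OF lin[OF assms(5)]])
qed

section \<open>Linear maps preserving the quaternionic forms\<close>

lemma bounded_bilinear_heis_omega: "bounded_bilinear (heis_omega r)"
proof -
  have "bilinear (heis_omega r)"
    unfolding bilinear_def
    by (intro conjI allI; rule linearI; simp add: heis_omega_def triple_def Let_def algebra_simps)
  then show ?thesis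
    by (simp add: bilinear_conv_bounded_bilinear)
qed

text \<open>This is \<open>\<bar>p\<bar>\<^sup>2 \<bar>q\<bar>\<^sup>2 = (Re (p cnj q))\<^sup>2 + \<bar>Im (p cnj q)\<bar>\<^sup>2\<close> for quaternions, polarised in the second
  argument.\<close>

lemma heis_omega_lagrange:
  "(\<Sum>r\<in>UNIV. heis_omega r x y * heis_omega r x z) = (x \<bullet> x) * (y \<bullet> z) - (x \<bullet> y) * (x \<bullet> z)"
  by (simp add: sum_3 heis_omega_def triple_def Let_def inner_vec_def sum_4 algebra_simps)

text \<open>Lagrange's identity, for \<open>Q\<close> and for the standard basis, turns the hypothesis into equations for
  the Gram matrix \<open>g\<close> of \<open>Q\<close>: \<open>g\<^sub>i\<^sub>i g\<^sub>j\<^sub>j - g\<^sub>i\<^sub>j\<^sup>2 = \<nu>\<^sup>2\<close> and \<open>g\<^sub>i\<^sub>i g\<^sub>j\<^sub>k = g\<^sub>i\<^sub>j g\<^sub>i\<^sub>k\<close> for distinct indices.  The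
  rotation \<open>\<Psi>\<close> disappears because the identity sums the products of the values of the three forms.\<close>

lemma quaternionic_frame_conformal:
  fixes Q :: "4 \<Rightarrow> real^4"
  assumes "\<nu> > 0" "rotation_matrix \<Psi>"
    and \<omega>: "\<And>r i j. heis_omega r (Q i) (Q j) =
      \<nu> * (\<Sum>s\<in>UNIV. \<Psi> $ r $ s * heis_omega s (axis i 1) (axis j 1))"
  shows "Q i \<bullet> Q j = (if i = j then \<nu> else 0)"
proof -
  define g where "g i j = Q i \<bullet> Q j" for i j
  have sym: "g i j = g j i" for i j
    by (simp add: g_def inner_commute)
  have rot: "orthogonal_transformation ((*v) \<Psi>)"
    using assms(2) by (simp add: rotation_matrix_def orthogonal_transformation_matrix)
  have lagrange: "g i i * g j k - g i j * g i k =
      \<nu>\<^sup>2 * ((if j = k then 1 else 0) - (if i = j \<and> i = k then 1 else 0))" for i j k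
  proof -
    define a where "a j = (\<chi> s. heis_omega s (axis i 1) (axis j 1))" for j
    have "heis_omega r (Q i) (Q j) = \<nu> * (\<Psi> *v a j) $ r" for r j
      by (simp add: \<omega> a_def matrix_vector_mult_def)
    then have "g i i * g j k - g i j * g i k = (\<Sum>r\<in>UNIV. (\<nu> * (\<Psi> *v a j) $ r) * (\<nu> * (\<Psi> *v a k) $ r))"
      unfolding g_def heis_omega_lagrange[symmetric] by simp
    also have "\<dots> = \<nu>\<^sup>2 * ((\<Psi> *v a j) \<bullet> (\<Psi> *v a k))"
      by (simp add: inner_vec_def sum_distrib_left power2_eq_square mult_ac)
    also have "\<dots> = \<nu>\<^sup>2 * (a j \<bullet> a k)"
      using rot by (simp add: orthogonal_transformation_def)
    also have "a j \<bullet> a k = (\<Sum>s\<in>UNIV. heis_omega s (axis i 1) (axis j 1) * heis_omega s (axis i 1) (axis k 1))"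
      by (simp add: a_def inner_vec_def)
    also have "\<dots> = (if j = k then 1 else 0) - (if i = j \<and> i = k then 1 else 0)"
      unfolding heis_omega_lagrange by (simp add: inner_axis_axis)
    finally show ?thesis .
  qed
  have area: "g i i * g j j - (g i j)\<^sup>2 = \<nu>\<^sup>2" if "i \<noteq> j" for i j
    using lagrange[of i j j] that by (simp add: power2_eq_square)
  have triple: "g i i * g j k = g i j * g i k" if "i \<noteq> j" "i \<noteq> k" "j \<noteq> k" for i j k
    using lagrange[of i j k] that by simp
  have third: "\<exists>k. k \<noteq> i \<and> k \<noteq> j" for i j :: 4
  proof -
    have "card {i, j} < card (UNIV :: 4 set)"
      by (simp add: card_insert_if)
    then have "{i, j} \<noteq> UNIV" by auto
    then show ?thesis by auto
  qed
  have pos: "g i i > 0" for i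
  proof -
    obtain j where "j \<noteq> i" using third by blast
    then have "g i i * g j j > 0"
      using area[of i j] assms(1) by (smt (verit) zero_le_power2 zero_less_power)
    then show ?thesis
      by (auto simp: g_def)
  qed
  have van: "g j k = 0" if ne: "g i j \<noteq> 0" "i \<noteq> j" "i \<noteq> k" "j \<noteq> k" for i j k
  proof -
    have "(g i i * g j j - (g i j)\<^sup>2) * g j k = g j j * (g i i * g j k) - g i j * (g i j * g j k)"
      by (simp add: algebra_simps power2_eq_square)
    also have "\<dots> = 0"
      using triple[of i j k] triple[of j i k] that by (simp add: sym[of j i])
    finally have "(g i i * g j j - (g i j)\<^sup>2) * g j k = 0" .
    then show ?thesis
      using area[of i j] that assms(1) by simp
  qed
  have off: "g i j = 0" if "i \<noteq> j" for i j
  proof (rule ccontr)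
    assume ne: "g i j \<noteq> 0"
    obtain k where k: "k \<noteq> i" "k \<noteq> j" using third by blast
    have "g k k * g i j = g k i * g k j"
      using triple[of k i j] k that by simp
    also have "\<dots> = 0"
      using van[OF ne that k(1)[symmetric] k(2)[symmetric]] sym by simp
    finally show False
      using ne pos[of k] by simp
  qed
  have diag: "g i i * g j j = \<nu>\<^sup>2" if "i \<noteq> j" for i j
    using area[OF that] off[OF that] by simp
  have "g i i = \<nu>" for i
  proof -
    obtain j where j: "j \<noteq> i" using third by blast
    obtain k where k: "k \<noteq> i" "k \<noteq> j" using third by blast
    have "g k k * g i i = g k k * g j j"
      using diag[of k i] diag[of k j] k by simp
    then have "g i i = g j j" using pos[of k] by simp
    then have "(g i i)\<^sup>2 = \<nu>\<^sup>2" using diag[of i j] j by (simp add: power2_eq_square)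
    then show ?thesis using pos[of i] assms(1) by (simp add: power2_eq_iff)
  qed
  then show ?thesis
    using off by (simp add: g_def)
qed

section \<open>The connection defined by a conformal frame\<close>

lemma orthogonal_expansion:
  fixes Q :: "'i \<Rightarrow> 'n::euclidean_space"
  assumes "finite J" "card J = DIM('n)" "\<nu> > 0"
    and gram: "\<And>i j. i \<in> J \<Longrightarrow> j \<in> J \<Longrightarrow> Q i \<bullet> Q j = (if i = j then \<nu> else 0)"
  shows "v \<bullet> w = (\<Sum>m\<in>J. (v \<bullet> Q m) * (w \<bullet> Q m)) / \<nu>"
proof -
  have inj: "inj_on Q J"
    using gram assms(3) by (intro inj_onI) (metis less_irrefl)
  have "pairwise orthogonal (Q ` J)"
    using gram by (auto simp: pairwise_def orthogonal_def)
  moreover have "0 \<notin> Q ` J"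
    using gram assms(3) by (auto simp: image_iff) (metis inner_zero_left less_irrefl)
  ultimately have "independent (Q ` J)"
    by (rule pairwise_orthogonal_independent)
  moreover have "card (Q ` J) = DIM('n)"
    using inj assms(2) by (simp add: card_image)
  ultimately have span: "span (Q ` J) = UNIV"
    by (metis card_eq_dim dim_UNIV subset_UNIV top.extremum_uniqueI independent_imp_finite)
  define z where "z = w - (\<Sum>m\<in>J. ((w \<bullet> Q m) / \<nu>) *\<^sub>R Q m)"
  have "Q k \<bullet> z = 0" if "k \<in> J" for k
  proof -
    have "Q k \<bullet> (\<Sum>m\<in>J. ((w \<bullet> Q m) / \<nu>) *\<^sub>R Q m) = (\<Sum>m\<in>J. if m = k then w \<bullet> Q m else 0)"
      unfolding inner_sum_right using gram that assms(3) by (intro sum.cong) auto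
    then show ?thesis
      using that assms(1) by (simp add: z_def inner_diff_right inner_commute)
  qed
  then have "z \<bullet> z = 0"
    using orthogonal_to_span[of z "Q ` J" z] span by (force simp: orthogonal_def inner_commute)
  then have "w = (\<Sum>m\<in>J. ((w \<bullet> Q m) / \<nu>) *\<^sub>R Q m)"
    by (simp add: z_def)
  then have "v \<bullet> w = v \<bullet> (\<Sum>m\<in>J. ((w \<bullet> Q m) / \<nu>) *\<^sub>R Q m)" by simp
  also have "\<dots> = (\<Sum>m\<in>J. (v \<bullet> Q m) * (w \<bullet> Q m)) / \<nu>"
    by (simp add: inner_sum_right sum_divide_distrib mult.commute)
  finally show ?thesis .
qed

text \<open>The trace that a map to the Heisenberg group leaves in its \<open>\<real>\<^sup>4\<close>-component: the derivatives along
  the horizontal fields form an orthogonal frame of vectors of equal length.  The distribution spanned by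
  the fields need not be integrable.\<close>

locale conformal_frame =
  fixes V :: "'b::euclidean_space set"
    and X :: "nat \<Rightarrow> 'b \<Rightarrow> 'b"
    and q :: "'b \<Rightarrow> real^4"
    and \<nu> :: "'b \<Rightarrow> real"
  assumes open_V: "open V"
    and smooth_X: "\<And>i. i \<in> {1..4} \<Longrightarrow> smooth_on V (X i)"
    and smooth_q: "smooth_on V q"
    and \<nu>_pos: "\<And>x. x \<in> V \<Longrightarrow> \<nu> x > 0"
    and gram: "\<And>x i j. x \<in> V \<Longrightarrow> i \<in> {1..4} \<Longrightarrow> j \<in> {1..4} \<Longrightarrow>
      along (X i) q x \<bullet> along (X j) q x = (if i = j then \<nu> x else 0)"
begin

text \<open>The coefficients \<open>\<Gamma>\<^sub>i\<^sub>j\<^sub>k\<close> in \<open>D\<^sub>i D\<^sub>j q = \<Sum>\<^sub>k \<Gamma>\<^sub>i\<^sub>j\<^sub>k D\<^sub>k q\<close>.  Orthogonality of the frame makes them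
  skew in \<open>j\<close>, \<open>k\<close> up to a common diagonal entry (lemmas \<open>conn_skew\<close> and \<open>conn_diag\<close>).\<close>

definition conn :: "nat \<Rightarrow> nat \<Rightarrow> nat \<Rightarrow> 'b \<Rightarrow> real" where
  "conn i j k x = (along (X i) (along (X j) q) x \<bullet> along (X k) q x) / \<nu> x"

lemma smooth_Q: "i \<in> {1..4} \<Longrightarrow> smooth_on V (along (X i) q)"
  by (intro smooth_on_along open_V smooth_X smooth_q)

lemma smooth_DQ: "i \<in> {1..4} \<Longrightarrow> j \<in> {1..4} \<Longrightarrow> smooth_on V (along (X i) (along (X j) q))"
  by (intro smooth_on_along open_V smooth_X smooth_Q)

lemma smooth_\<nu>: "smooth_on V \<nu>"
  by (rule smooth_on_cong[OF open_V _ smooth_on_inner[OF open_V smooth_Q[of 1] smooth_Q[of 1]]])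
     (auto simp: gram)

lemma parseval:
  assumes "x \<in> V"
  shows "v \<bullet> w = (\<Sum>m=1..4. (v \<bullet> along (X m) q x) * (w \<bullet> along (X m) q x)) / \<nu> x"
  using assms by (intro orthogonal_expansion) (auto simp: \<nu>_pos gram)

lemma DQ_inner:
  assumes "x \<in> V"
  shows "along (X i) (along (X j) q) x \<bullet> along (X k) (along (X l) q) x =
    \<nu> x * (\<Sum>m=1..4. conn i j m x * conn k l m x)"
  using \<nu>_pos[OF assms]
  by (subst parseval[OF assms]) (simp add: conn_def sum_distrib_left sum_divide_distrib field_simps)

lemma gram_derivative:
  assumes "x \<in> V" "i \<in> {1..4}" "j \<in> {1..4}" "k \<in> {1..4}"
  shows "along (X i) (along (X j) q) x \<bullet> along (X k) q x + along (X j) q x \<bullet> along (X i) (along (X k) q) x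
    = (if j = k then along (X i) \<nu> x else 0)"
proof -
  have diff: "along (X j) q differentiable at x" "along (X k) q differentiable at x"
    using assms by (auto intro: smooth_on_differentiable[OF smooth_Q])
  have "along (X i) (\<lambda>y. along (X j) q y \<bullet> along (X k) q y) x = (if j = k then along (X i) \<nu> x else 0)"
  proof (cases "j = k")
    case True
    have "along (X i) \<nu> x = along (X i) (\<lambda>y. along (X j) q y \<bullet> along (X k) q y) x"
      using assms True
      by (intro along_cong[OF open_V]) (auto simp: gram intro: smooth_on_differentiable[OF smooth_\<nu>])
    with True show ?thesis by simp
  next
    case False
    then show ?thesis
      using assms by (simp add: along_const_on[OF open_V] gram)
  qed
  then show ?thesis
    using along_inner[OF diff, of "X i"] by (simp add: add.commute)
qed

lemma conn_skew:
  assumes "x \<in> V" "i \<in> {1..4}" "j \<in> {1..4}" "k \<in> {1..4}" "j \<noteq> k"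
  shows "conn i k j x = - conn i j k x"
  using gram_derivative[OF assms(1-4)] assms(5) \<nu>_pos[OF assms(1)]
  by (simp add: conn_def field_simps inner_commute)

lemma conn_diag:
  assumes "x \<in> V" "i \<in> {1..4}" "j \<in> {1..4}"
  shows "conn i j j x = along (X i) \<nu> x / (2 * \<nu> x)"
  using gram_derivative[OF assms(1-3) assms(3)] \<nu>_pos[OF assms(1)]
  by (simp add: conn_def field_simps inner_commute)

lemma conn_differentiable:
  assumes "x \<in> V" "i \<in> {1..4}" "j \<in> {1..4}" "k \<in> {1..4}"
  shows "conn i j k differentiable at x"
proof -
  have "(\<lambda>x. along (X i) (along (X j) q) x \<bullet> along (X k) q x) differentiable at x"
    using assms by (intro smooth_on_differentiable[OF smooth_on_inner[OF open_V smooth_DQ smooth_Q]])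
  then show ?thesis
    unfolding conn_def[abs_def]
    using smooth_on_differentiable[OF smooth_\<nu> assms(1)] \<nu>_pos[OF assms(1)]
    by (intro differentiable_divide) auto
qed

lemma along_conn:
  assumes "x \<in> V" "i \<in> {1..4}" "j \<in> {1..4}" "k \<in> {1..4}" "l \<in> {1..4}"
  shows "along (X i) (conn j k l) x =
    along (X i) (along (X j) (along (X k) q)) x \<bullet> along (X l) q x / \<nu> x
      + (\<Sum>m=1..4. conn j k m x * conn i l m x) - 2 * conn j k l x * conn i k k x"
proof -
  let ?T = "\<lambda>x. along (X j) (along (X k) q) x \<bullet> along (X l) q x"
  have diff: "along (X j) (along (X k) q) differentiable at x" "along (X l) q differentiable at x"
    "\<nu> differentiable at x"
    using assms by (auto intro!: smooth_on_differentiable[OF _ assms(1)] smooth_DQ smooth_Q smooth_\<nu>)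
  have T: "?T differentiable at x"
    using assms by (intro smooth_on_differentiable[OF smooth_on_inner[OF open_V smooth_DQ smooth_Q]])
  have "along (X i) (conn j k l) x = along (X i) ?T x / \<nu> x - ?T x * along (X i) \<nu> x / (\<nu> x)\<^sup>2"
    unfolding conn_def[abs_def] using along_divide[OF T diff(3)] \<nu>_pos[OF assms(1)] by simp
  also have "along (X i) ?T x = along (X i) (along (X j) (along (X k) q)) x \<bullet> along (X l) q x
      + \<nu> x * (\<Sum>m=1..4. conn j k m x * conn i l m x)"
    by (simp only: along_inner[OF diff(1,2)] DQ_inner[OF assms(1)])
  finally have "along (X i) (conn j k l) x = along (X i) (along (X j) (along (X k) q)) x \<bullet> along (X l) q x / \<nu> x
      + (\<Sum>m=1..4. conn j k m x * conn i l m x) - ?T x * along (X i) \<nu> x / (\<nu> x)\<^sup>2"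
    using \<nu>_pos[OF assms(1)] by (simp only: add_divide_distrib) simp
  moreover have "?T x * along (X i) \<nu> x / (\<nu> x)\<^sup>2 = 2 * conn j k l x * conn i k k x"
    by (simp add: conn_diag[OF assms(1,2,4)] conn_def[of j k l] power2_eq_square)
  ultimately show ?thesis by simp
qed

text \<open>Flatness of the connection: both sides compare the two orders of differentiation of a vector valued
  function.  In the quadratic terms the summands with \<open>m = k\<close> and \<open>m = l\<close> are missing because they cancel
  against the derivative of the conformal factor in the denominator of \<open>\<Gamma>\<close>.\<close>

lemma conn_curvature:
  assumes "x \<in> V" "i \<in> {1..4}" "j \<in> {1..4}" "k \<in> {1..4}" "l \<in> {1..4}" "k \<noteq> l"
  shows "along (X i) (conn j k l) x - along (X j) (conn i k l) x =
    (along (X i) (along (X j) (along (X k) q)) x - along (X j) (along (X i) (along (X k) q)) x)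
        \<bullet> along (X l) q x / \<nu> x
      + (\<Sum>m\<in>{1..4}-{k,l}. conn j k m x * conn i l m x - conn i k m x * conn j l m x)"
proof -
  have "(\<Sum>m=1..4. conn j k m x * conn i l m x) - (\<Sum>m=1..4. conn i k m x * conn j l m x)
    = (\<Sum>m=1..4. conn j k m x * conn i l m x - conn i k m x * conn j l m x)"
    by (simp add: sum_subtractf)
  also have "\<dots> = (\<Sum>m\<in>{1..4}-{k,l}. conn j k m x * conn i l m x - conn i k m x * conn j l m x)
    + (\<Sum>m\<in>{k,l}. conn j k m x * conn i l m x - conn i k m x * conn j l m x)"
    by (rule sum.subset_diff) (use assms in auto)
  also have "(\<Sum>m\<in>{k,l}. conn j k m x * conn i l m x - conn i k m x * conn j l m x)
    = 2 * conn j k l x * conn i k k x - 2 * conn i k l x * conn j k k x"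
    using assms(6) conn_skew[OF assms(1,2,4,5,6)] conn_skew[OF assms(1,3,4,5,6)]
      conn_diag[OF assms(1,2,4)] conn_diag[OF assms(1,2,5)] conn_diag[OF assms(1,3,4)] conn_diag[OF assms(1,3,5)]
    by (simp add: algebra_simps)
  finally show ?thesis
    by (simp add: along_conn[OF assms(1,2,3,4,5)] along_conn[OF assms(1,3,2,4,5)] inner_diff_left diff_divide_distrib)
qed


text \<open>Commutators of \<open>q\<close> itself give the torsion equations of the connection, commutators of its
  derivatives the curvature equations; both are needed only for the combinations of two brackets that
  belong to an anti-self-dual bivector.\<close>

lemma bracket_constraint:
  assumes "x \<in> V" "i \<in> {1..4}" "j \<in> {1..4}" "k \<in> {1..4}" "l \<in> {1..4}" "m \<in> {1..4}" "n \<in> {1..4}"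
    and "along (X i) (along (X j) q) x - along (X j) (along (X i) q) x
      - (along (X k) (along (X l) q) x - along (X l) (along (X k) q) x) = \<kappa> *\<^sub>R along (X m) q x"
  shows "conn i j n x - conn j i n x - (conn k l n x - conn l k n x) = (if m = n then \<kappa> else 0)"
proof -
  have "conn i j n x - conn j i n x - (conn k l n x - conn l k n x) =
    (along (X i) (along (X j) q) x - along (X j) (along (X i) q) x
      - (along (X k) (along (X l) q) x - along (X l) (along (X k) q) x)) \<bullet> along (X n) q x / \<nu> x"
    by (simp add: conn_def inner_diff_left diff_divide_distrib)
  also have "\<dots> = (if m = n then \<kappa> else 0)"
    unfolding assms(8) using gram[OF assms(1,6,7)] \<nu>_pos[OF assms(1)] by simp
  finally show ?thesis .
qed

lemma bracket_curvature:
  assumes "x \<in> V" "i \<in> {1..4}" "j \<in> {1..4}" "k \<in> {1..4}" "l \<in> {1..4}" "m \<in> {1..4}"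
    "a \<in> {1..4}" "b \<in> {1..4}" "a \<noteq> b"
    and "along (X i) (along (X j) (along (X a) q)) x - along (X j) (along (X i) (along (X a) q)) x
      - (along (X k) (along (X l) (along (X a) q)) x - along (X l) (along (X k) (along (X a) q)) x)
      = \<kappa> *\<^sub>R along (X m) (along (X a) q) x"
  shows "along (X i) (conn j a b) x - along (X j) (conn i a b) x
      - (along (X k) (conn l a b) x - along (X l) (conn k a b) x) = \<kappa> * conn m a b x
      + (\<Sum>n\<in>{1..4}-{a,b}. conn j a n x * conn i b n x - conn i a n x * conn j b n x
          - (conn l a n x * conn k b n x - conn k a n x * conn l b n x))"
proof -
  have "(along (X i) (along (X j) (along (X a) q)) x - along (X j) (along (X i) (along (X a) q)) x) \<bullet> along (X b) q x / \<nu> x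
      - (along (X k) (along (X l) (along (X a) q)) x - along (X l) (along (X k) (along (X a) q)) x) \<bullet> along (X b) q x / \<nu> x
    = \<kappa> * conn m a b x"
    unfolding inner_diff_left[symmetric] diff_divide_distrib[symmetric] assms(10) by (simp add: conn_def)
  then show ?thesis
    using conn_curvature[OF assms(1,2,3,7,8,9)] conn_curvature[OF assms(1,4,5,7,8,9)]
    by (simp add: sum_subtractf)
qed

text \<open>Let \<open>a\<^sub>1\<close>, \<open>a\<^sub>2\<close>, \<open>a\<^sub>3\<close> be the anti-self-dual components of the connection, belonging to the bivectors
  \<open>12 - 34\<close>, \<open>13 - 42\<close>, \<open>14 - 23\<close>.  The torsion equations \<open>c1\<close> to \<open>c5\<close> below relate their values on the four
  vector fields.  Because of them the curvature components \<open>R2\<close> (the second component evaluated on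
  \<open>13 - 42\<close>) and \<open>R3\<close> (the third on \<open>14 - 23\<close>) contain the same derivatives, so the quadratic expressions
  that the curvature equations give for them have to agree.  Substituting the torsion equations, those
  differ by the constant \<open>-10/3\<close>.\<close>

lemma no_G2_brackets:
  assumes "V \<noteq> {}"
    and br12: "\<And>f :: 'b \<Rightarrow> real^4. \<And>x. smooth_on V f \<Longrightarrow> x \<in> V \<Longrightarrow>
      along (X 1) (along (X 2) f) x - along (X 2) (along (X 1) f) x
      - (along (X 3) (along (X 4) f) x - along (X 4) (along (X 3) f) x) = (-1) *\<^sub>R along (X 2) f x"
    and br13: "\<And>f :: 'b \<Rightarrow> real^4. \<And>x. smooth_on V f \<Longrightarrow> x \<in> V \<Longrightarrow>
      along (X 1) (along (X 3) f) x - along (X 3) (along (X 1) f) x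
      - (along (X 4) (along (X 2) f) x - along (X 2) (along (X 4) f) x) = (5/3) *\<^sub>R along (X 3) f x"
    and br14: "\<And>f :: 'b \<Rightarrow> real^4. \<And>x. smooth_on V f \<Longrightarrow> x \<in> V \<Longrightarrow>
      along (X 1) (along (X 4) f) x - along (X 4) (along (X 1) f) x
      - (along (X 2) (along (X 3) f) x - along (X 3) (along (X 2) f) x) = (2/3) *\<^sub>R along (X 4) f x"
  shows False
proof -
  define a2 where "a2 i x = conn i 1 3 x - conn i 4 2 x" for i x
  define a3 where "a3 i x = conn i 1 4 x - conn i 2 3 x" for i x
  have skew: "conn i 2 1 x = - conn i 1 2 x" "conn i 3 1 x = - conn i 1 3 x" "conn i 4 1 x = - conn i 1 4 x"
    "conn i 3 2 x = - conn i 2 3 x" "conn i 2 4 x = - conn i 4 2 x" "conn i 4 3 x = - conn i 3 4 x"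
    if "x \<in> V" "i \<in> {1..4}" for i x
    using that by (auto intro: conn_skew)
  have diag: "conn i 2 2 x = conn i 1 1 x" "conn i 3 3 x = conn i 1 1 x" "conn i 4 4 x = conn i 1 1 x"
    if "x \<in> V" "i \<in> {1..4}" for i x
    using that by (simp_all add: conn_diag)
  have t12: "conn 1 2 n x - conn 2 1 n x - (conn 3 4 n x - conn 4 3 n x) = (if 2 = n then -1 else 0)"
   and t13: "conn 1 3 n x - conn 3 1 n x - (conn 4 2 n x - conn 2 4 n x) = (if 3 = n then 5/3 else 0)"
   and t14: "conn 1 4 n x - conn 4 1 n x - (conn 2 3 n x - conn 3 2 n x) = (if 4 = n then 2/3 else 0)"
    if "x \<in> V" "n \<in> {1..4}" for n x
    using that by (intro bracket_constraint br12 br13 br14 smooth_q; simp)+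
  \<comment> \<open>Each equation is the sum or difference of two torsion equations that eliminates the trace part
    and the self-dual part of the connection.\<close>
  have c1: "a3 4 x - a2 3 x = 1" and c2: "a2 1 x + a3 2 x = 0" and c3: "a3 1 x - a2 2 x = 0"
   and c4: "a2 4 x + a3 3 x = 0"
   and c5: "conn 2 1 2 x - conn 2 3 4 x - a2 3 x = 8/3"
    if "x \<in> V" for x
    using t12[OF that, of 1] t12[OF that, of 2] t12[OF that, of 3] t12[OF that, of 4]
      t13[OF that, of 1] t13[OF that, of 2] t13[OF that, of 3] t13[OF that, of 4]
      t14[OF that, of 1] t14[OF that, of 2] t14[OF that, of 3] t14[OF that, of 4]
    by (simp_all add: a2_def a3_def skew[OF that] diag[OF that] del: One_nat_def)
  obtain x where x: "x \<in> V" using assms(1) by blast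
  have diff: "conn i j k differentiable at x" if "i \<in> {1..4}" "j \<in> {1..4}" "k \<in> {1..4}" for i j k
    using conn_differentiable[OF x] that by blast
  have diff_a: "a2 i differentiable at x" "a3 i differentiable at x" if "i \<in> {1..4}" for i
    unfolding a2_def[abs_def] a3_def[abs_def] using that by (auto intro!: differentiable_diff diff)
  have along_a2: "along (X i) (a2 j) x = along (X i) (conn j 1 3) x - along (X i) (conn j 4 2) x"
   and along_a3: "along (X i) (a3 j) x = along (X i) (conn j 1 4) x - along (X i) (conn j 2 3) x"
    if "j \<in> {1..4}" for i j
    unfolding a2_def[abs_def] a3_def[abs_def] using that by (auto intro!: along_diff diff)
  have d1: "along (X 1) (a3 4) x = along (X 1) (a2 3) x"
    using along_const_on[where f="\<lambda>x. a3 4 x - a2 3 x", OF open_V x c1] along_diff[OF diff_a(2)[of 4] diff_a(1)[of 3]] by simp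
  have d2: "along (X 3) (a2 1) x = - along (X 3) (a3 2) x"
    using along_const_on[where f="\<lambda>x. a2 1 x + a3 2 x", OF open_V x c2] along_add[OF diff_a(1)[of 1] diff_a(2)[of 2]]
    by (simp add: eq_neg_iff_add_eq_0)
  have d3: "along (X 4) (a3 1) x = along (X 4) (a2 2) x"
    using along_const_on[where f="\<lambda>x. a3 1 x - a2 2 x", OF open_V x c3] along_diff[OF diff_a(2)[of 1] diff_a(1)[of 2]] by simp
  have d4: "along (X 2) (a2 4) x = - along (X 2) (a3 3) x"
    using along_const_on[where f="\<lambda>x. a2 4 x + a3 3 x", OF open_V x c4] along_add[OF diff_a(1)[of 4] diff_a(2)[of 3]]
    by (simp add: eq_neg_iff_add_eq_0)
  have sets: "{1..4} - {1,3::nat} = {2,4}" "{1..4} - {4,2::nat} = {1,3}"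
    "{1..4} - {1,4::nat} = {2,3}" "{1..4} - {2,3::nat} = {1,4}"
    by auto
  note curv2 = bracket_curvature[OF x, of 1 3 4 2 3 _ _ "5/3"]
  note curv3 = bracket_curvature[OF x, of 1 4 2 3 4 _ _ "2/3"]
  have R13: "along (X 1) (conn 3 1 3) x - along (X 3) (conn 1 1 3) x
      - (along (X 4) (conn 2 1 3) x - along (X 2) (conn 4 1 3) x) = 5/3 * conn 3 1 3 x
      + (\<Sum>n\<in>{1..4}-{1,3}. conn 3 1 n x * conn 1 3 n x - conn 1 1 n x * conn 3 3 n x
          - (conn 2 1 n x * conn 4 3 n x - conn 4 1 n x * conn 2 3 n x))"
    by (rule curv2[OF _ _ _ _ _ _ _ _ br13[OF smooth_Q x]]) simp_all
  have R42: "along (X 1) (conn 3 4 2) x - along (X 3) (conn 1 4 2) x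
      - (along (X 4) (conn 2 4 2) x - along (X 2) (conn 4 4 2) x) = 5/3 * conn 3 4 2 x
      + (\<Sum>n\<in>{1..4}-{4,2}. conn 3 4 n x * conn 1 2 n x - conn 1 4 n x * conn 3 2 n x
          - (conn 2 4 n x * conn 4 2 n x - conn 4 4 n x * conn 2 2 n x))"
    by (rule curv2[OF _ _ _ _ _ _ _ _ br13[OF smooth_Q x]]) simp_all
  have R14: "along (X 1) (conn 4 1 4) x - along (X 4) (conn 1 1 4) x
      - (along (X 2) (conn 3 1 4) x - along (X 3) (conn 2 1 4) x) = 2/3 * conn 4 1 4 x
      + (\<Sum>n\<in>{1..4}-{1,4}. conn 4 1 n x * conn 1 4 n x - conn 1 1 n x * conn 4 4 n x
          - (conn 3 1 n x * conn 2 4 n x - conn 2 1 n x * conn 3 4 n x))"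
    by (rule curv3[OF _ _ _ _ _ _ _ _ br14[OF smooth_Q x]]) simp_all
  have R23: "along (X 1) (conn 4 2 3) x - along (X 4) (conn 1 2 3) x
      - (along (X 2) (conn 3 2 3) x - along (X 3) (conn 2 2 3) x) = 2/3 * conn 4 2 3 x
      + (\<Sum>n\<in>{1..4}-{2,3}. conn 4 2 n x * conn 1 3 n x - conn 1 2 n x * conn 4 3 n x
          - (conn 3 2 n x * conn 2 3 n x - conn 2 2 n x * conn 3 3 n x))"
    by (rule curv3[OF _ _ _ _ _ _ _ _ br14[OF smooth_Q x]]) simp_all
  \<comment> \<open>The component \<open>a1\<close> enters only algebraically and so is needed only at the point \<open>x\<close>.\<close>
  define a1 where "a1 i = conn i 1 2 x - conn i 3 4 x" for i
  note sk = skew[OF x]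
  have R2: "along (X 1) (a2 3) x - along (X 3) (a2 1) x - along (X 4) (a2 2) x + along (X 2) (a2 4) x =
    5/3 * a2 3 x + (a3 1 x * a1 3 - a1 1 * a3 3 x) - (a3 4 x * a1 2 - a1 4 * a3 2 x)"
    using R13 R42 unfolding sets a1_def a2_def[of _ x] a3_def[of _ x]
    by (simp add: along_a2 sk algebra_simps del: One_nat_def)
  have R3: "along (X 1) (a3 4) x - along (X 4) (a3 1) x - along (X 2) (a3 3) x + along (X 3) (a3 2) x =
    2/3 * a3 4 x + (a1 1 * a2 4 x - a2 1 x * a1 4) - (a1 2 * a2 3 x - a2 2 x * a1 3)"
    using R14 R23 unfolding sets a1_def a2_def[of _ x] a3_def[of _ x]
    by (simp add: along_a3 sk algebra_simps del: One_nat_def)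
  have "5/3 * a2 3 x + (a3 1 x * a1 3 - a1 1 * a3 3 x) - (a3 4 x * a1 2 - a1 4 * a3 2 x) =
    2/3 * a3 4 x + (a1 1 * a2 4 x - a2 1 x * a1 4) - (a1 2 * a2 3 x - a2 2 x * a1 3)"
    using R2 R3 d1 d2 d3 d4 by linarith
  \<comment> \<open>With \<open>z = a2 3 x\<close> the left side exceeds the right side by
    \<open>5/3 z - 2/3 (z + 1) - (z + 8/3) = -10/3\<close>.\<close>
  moreover have "a3 1 x = a2 2 x" "a3 3 x = - a2 4 x" "a3 2 x = - a2 1 x" "a3 4 x = a2 3 x + 1" "a1 2 = a2 3 x + 8/3"
    using c1[OF x] c2[OF x] c3[OF x] c4[OF x] c5[OF x] by (auto simp: a1_def)
  ultimately show False
    by (simp add: field_simps)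
qed

end

section \<open>The left invariant coframe\<close>

lemma index_set7: "{1..7::nat} = {1,2,3,4,5,6,7}" and index_set4: "{1..4::nat} = {1,2,3,4}"
  by auto

lemma triple_simps [simp]: "triple a b c 1 = a" "triple a b c 2 = b" "triple a b c 3 = c"
  by (simp_all add: triple_def)

lemma dual_family_independent:
  fixes E :: "'i \<Rightarrow> 'b::euclidean_space" and e :: "'i \<Rightarrow> 'b \<Rightarrow> real"
  assumes "finite J" "\<And>i. i \<in> J \<Longrightarrow> linear (e i)"
    and dual: "\<And>i j. i \<in> J \<Longrightarrow> j \<in> J \<Longrightarrow> e i (E j) = (if i = j then 1 else 0)"
  shows "inj_on E J" "independent (E ` J)"
proof -
  show inj: "inj_on E J"
    using dual by (intro inj_onI) (metis zero_neq_one)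
  show "independent (E ` J)"
  proof (rule independent_if_scalars_zero)
    fix f v assume sum: "(\<Sum>v\<in>E ` J. f v *\<^sub>R v) = 0" and "v \<in> E ` J"
    then obtain i where i: "i \<in> J" "v = E i" by blast
    have "0 = e i (\<Sum>j\<in>J. f (E j) *\<^sub>R E j)"
      using sum i by (simp add: sum.reindex[OF inj] linear_0[OF assms(2)])
    also have "\<dots> = (\<Sum>j\<in>J. if j = i then f (E j) else 0)"
      using i by (simp add: linear_sum[OF assms(2)] linear_cmul[OF assms(2)] dual if_distrib cong: if_cong)
         (intro sum.cong, auto)
    finally show "f v = 0" using i assms(1) by simp
  qed (use assms(1) in simp)
qed

lemma dual_basis_expansion:
  fixes E :: "'i \<Rightarrow> 'b::euclidean_space" and e :: "'i \<Rightarrow> 'b \<Rightarrow> real"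
  assumes "finite J" "card J = DIM('b)" "\<And>i. i \<in> J \<Longrightarrow> linear (e i)"
    and dual: "\<And>i j. i \<in> J \<Longrightarrow> j \<in> J \<Longrightarrow> e i (E j) = (if i = j then 1 else 0)"
  shows "(\<Sum>i\<in>J. e i v *\<^sub>R E i) = v"
proof -
  note ind = dual_family_independent[OF assms(1,3,4)]
  have "card (E ` J) = DIM('b)"
    using ind(1) assms(2) by (simp add: card_image)
  then have span: "span (E ` J) = UNIV"
    using ind(2) by (metis card_eq_dim dim_UNIV subset_UNIV top.extremum_uniqueI independent_imp_finite)
  have "linear (\<lambda>v. \<Sum>i\<in>J. e i v *\<^sub>R E i)"
    using assms(3)
    by (intro linear_compose_sum ballI linearI) (auto simp: linear_add linear_cmul scaleR_add_left)
  moreover have "(\<Sum>i\<in>J. e i b *\<^sub>R E i) = b" if b: "b \<in> E ` J" for b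
  proof -
    obtain j where j: "j \<in> J" "b = E j" using b by blast
    have "(\<Sum>i\<in>J. e i b *\<^sub>R E i) = (\<Sum>i\<in>J. if i = j then E i else 0)"
      using j by (intro sum.cong) (auto simp: dual)
    then show ?thesis using j assms(1) by simp
  qed
  ultimately show ?thesis
    using linear_eq_on_span[of "\<lambda>v. \<Sum>i\<in>J. e i v *\<^sub>R E i" "\<lambda>v. v" "E ` J" v] span
    by (auto intro: linear_ident)
qed

locale G2_frame =
  fixes A :: "('a::topological_space, real^7) chart set"
    and e :: "nat \<Rightarrow> ('a, real^7) form1"
    and E :: "nat \<Rightarrow> ('a, real^7) vfield"
  assumes atlas: "smooth_atlas A"
    and form: "\<And>i. i \<in> {1..7} \<Longrightarrow> one_form A (e i)"
    and field: "\<And>i. i \<in> {1..7} \<Longrightarrow> vector_field A (E i)"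
    and dual: "\<And>c x i j. c \<in> A \<Longrightarrow> x \<in> snd c ` fst c \<Longrightarrow> i \<in> {1..7} \<Longrightarrow> j \<in> {1..7} \<Longrightarrow>
           e i c x (E j c x) = (if i = j then 1 else 0)"
    and structure_eqs: "G2_structure_equations A e"
begin

lemma open_chart: "c \<in> A \<Longrightarrow> open (snd c ` fst c)"
  and homeo_chart: "c \<in> A \<Longrightarrow> homeomorphism (fst c) (snd c ` fst c) (snd c) (chart_inv c)"
  using atlas by (auto simp: smooth_atlas_def)

lemma open_chart_image:
  assumes "c \<in> A" "open U"
  shows "open (snd c ` (fst c \<inter> U))"
proof -
  have "openin (top_of_set (snd c ` fst c)) (snd c ` (fst c \<inter> U))"
    using assms by (intro homeomorphism_imp_open_map[OF homeo_chart]) (auto simp: openin_open)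
  then show ?thesis
    using open_chart[OF assms(1)] by (metis openin_open_eq)
qed

lemma chart_inv: "c \<in> A \<Longrightarrow> p \<in> fst c \<Longrightarrow> chart_inv c (snd c p) = p"
  using homeo_chart by (auto simp: homeomorphism_def)

lemma linear_e: "c \<in> A \<Longrightarrow> x \<in> snd c ` fst c \<Longrightarrow> i \<in> {1..7} \<Longrightarrow> linear (e i c x)"
  and smooth_e: "c \<in> A \<Longrightarrow> i \<in> {1..7} \<Longrightarrow> smooth_on (snd c ` fst c) (\<lambda>x. e i c x v)"
  using form by (auto simp: one_form_def)

lemma smooth_E: "c \<in> A \<Longrightarrow> i \<in> {1..7} \<Longrightarrow> smooth_on (snd c ` fst c) (E i c)"
  using field by (auto simp: vector_field_def)

lemma expansion:
  assumes "c \<in> A" "x \<in> snd c ` fst c"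
  shows "(\<Sum>i=1..7. e i c x v *\<^sub>R E i c x) = v"
  using assms by (intro dual_basis_expansion[where e="\<lambda>i. e i c x"]) (auto simp: linear_e dual)

text \<open>Cartan's formula; the derivatives of the constants \<open>e\<^sup>k(E\<^sub>i)\<close> and \<open>e\<^sup>k(E\<^sub>j)\<close> drop out.\<close>

lemma ext_deriv_frame:
  assumes "c \<in> A" "x \<in> snd c ` fst c" "i \<in> {1..7}" "j \<in> {1..7}" "k \<in> {1..7}"
  shows "ext_deriv (e k) c x (E i c x) (E j c x) = - e k c x (along (E i c) (E j c) x - along (E j c) (E i c) x)"
proof -
  have "frechet_derivative (\<lambda>y. e k c y (E n c x)) (at x) (E m c x) = - e k c x (along (E m c) (E n c) x)"
    if "m \<in> {1..7}" "n \<in> {1..7}" for m n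
  proof -
    have "along (E m c) (\<lambda>y. e k c y (E n c y)) x = 0"
      using assms that by (intro along_const_on[OF open_chart]) (auto simp: dual)
    then show ?thesis
      using along_linear_apply[where \<alpha>="e k c" and Y="E n c" and X="E m c", OF open_chart[OF assms(1)] _ _ _ assms(2)]
        assms that by (simp add: linear_e smooth_e smooth_E)
  qed
  then show ?thesis
    using assms by (simp add: ext_deriv_def linear_diff[OF linear_e])
qed

lemma frame_bracket:
  fixes f :: "real^7 \<Rightarrow> 'c::euclidean_space"
  assumes "c \<in> A" "V \<subseteq> snd c ` fst c" "open V" "smooth_on V f" "x \<in> V" "i \<in> {1..7}" "j \<in> {1..7}"
  shows "along (E i c) (along (E j c) f) x - along (E j c) (along (E i c) f) x =
    - (\<Sum>k=1..7. ext_deriv (e k) c x (E i c x) (E j c x) *\<^sub>R along (E k c) f x)"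
proof -
  let ?w = "along (E i c) (E j c) x - along (E j c) (E i c) x"
  have x: "x \<in> snd c ` fst c" using assms by blast
  have lin: "linear (frechet_derivative f (at x))"
    using smooth_on_has_derivative[OF assms(4,5)] by (rule has_derivative_linear)
  have "along (E i c) (along (E j c) f) x - along (E j c) (along (E i c) f) x = frechet_derivative f (at x) ?w"
    using assms by (intro along_bracket[where S=V] smooth_on_subset[OF smooth_E]) auto
  also have "\<dots> = frechet_derivative f (at x) (\<Sum>k=1..7. e k c x ?w *\<^sub>R E k c x)"
    using expansion[OF assms(1) x] by simp
  also have "\<dots> = (\<Sum>k=1..7. e k c x ?w *\<^sub>R along (E k c) f x)"
    by (simp add: linear_sum[OF lin] linear_cmul[OF lin] along_def)
  also have "\<dots> = - (\<Sum>k=1..7. ext_deriv (e k) c x (E i c x) (E j c x) *\<^sub>R along (E k c) f x)"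
    unfolding sum_negf[symmetric]
    using assms x by (intro sum.cong refl) (simp add: ext_deriv_frame)
  finally show ?thesis .
qed

lemma de:
  assumes "c \<in> A" "x \<in> snd c ` fst c"
  shows "ext_deriv (e 1) c x u v = 0"
    "ext_deriv (e 2) c x u v = 2/3 * wedge (e 1) (e 2) c x u v + 1/6 * wedge (e 1) (e 5) c x u v
       - 1/3 * wedge (e 3) (e 4) c x u v + 1/6 * wedge (e 4) (e 6) c x u v"
    "ext_deriv (e 3) c x u v = - (2/3) * wedge (e 1) (e 3) c x u v + 1/6 * wedge (e 1) (e 6) c x u v
       - wedge (e 2) (e 4) c x u v - 1/6 * wedge (e 4) (e 5) c x u v"
    "ext_deriv (e 4) c x u v = - (2/3) * wedge (e 1) (e 4) c x u v"
    "ext_deriv (e 5) c x u v = 2 * (wedge (e 1) (e 2) c x u v + wedge (e 3) (e 4) c x u v) - wedge (e 4) (e 6) c x u v"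
    "ext_deriv (e 6) c x u v = 2 * (wedge (e 1) (e 3) c x u v + wedge (e 4) (e 2) c x u v) + wedge (e 4) (e 5) c x u v"
    "ext_deriv (e 7) c x u v = 2 * (wedge (e 1) (e 4) c x u v + wedge (e 2) (e 3) c x u v) - 1/6 * wedge (e 5) (e 6) c x u v"
  using structure_eqs assms unfolding G2_structure_equations_def Let_def by blast+

section \<open>The quaternionic contact structure\<close>

definition horizontal :: "('a, real^7) distribution" where
  "horizontal c x = span {E i c x | i. i \<in> {1..4}}"

definition hor_metric :: "('a, real^7) form2" where
  "hor_metric c x u v = (\<Sum>i=1..4. e i c x u * e i c x v)"

text \<open>The endomorphism of \<open>H\<close> that corresponds to \<open>\<omega>\<^sub>r\<close> under the metric, written in the orthonormal
  basis.\<close>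

definition hor_acs :: "3 \<Rightarrow> ('a, real^7) endo" where
  "hor_acs r c x u = (\<Sum>j=1..4. fundamental_forms e r c x u (E j c x) *\<^sub>R E j c x)"

abbreviation contact :: "3 \<Rightarrow> ('a, real^7) form1" where
  "contact \<equiv> triple (e 5) (e 6) (e 7)"

lemma frame_eqI:
  assumes "c \<in> A" "x \<in> snd c ` fst c" "\<And>i. i \<in> {1..7} \<Longrightarrow> e i c x u = e i c x v"
  shows "u = v"
  using expansion[OF assms(1,2), of u] expansion[OF assms(1,2), of v] assms(3) by simp

lemma e_frame_sum:
  assumes "c \<in> A" "x \<in> snd c ` fst c" "i \<in> {1..7}"
  shows "e i c x (\<Sum>j=1..4. a j *\<^sub>R E j c x) = (if i \<in> {1..4} then a i else 0)"
proof -
  have "e i c x (\<Sum>j=1..4. a j *\<^sub>R E j c x) = (\<Sum>j=1..4. a j * e i c x (E j c x))"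
    using assms by (simp add: linear_sum[OF linear_e] linear_cmul[OF linear_e])
  also have "\<dots> = (\<Sum>j=1..4. if j = i then a j else 0)"
    using assms by (intro sum.cong refl) (auto simp: dual)
  finally show ?thesis by simp
qed

lemma horizontal_iff:
  assumes "c \<in> A" "x \<in> snd c ` fst c"
  shows "u \<in> horizontal c x \<longleftrightarrow> e 5 c x u = 0 \<and> e 6 c x u = 0 \<and> e 7 c x u = 0"
proof
  assume u: "u \<in> horizontal c x"
  have "e i c x u = 0" if "i \<in> {5..7}" for i
  proof (rule linear_eq_0_on_span[OF linear_e[OF assms]])
    show "i \<in> {1..7}" using that by auto
    show "e i c x b = 0" if "b \<in> {E i c x | i. i \<in> {1..4}}" for b
      using that \<open>i \<in> {5..7}\<close> by (auto simp: dual[OF assms])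
  qed (use u in \<open>simp add: horizontal_def\<close>)
  then show "e 5 c x u = 0 \<and> e 6 c x u = 0 \<and> e 7 c x u = 0" by simp
next
  assume 0: "e 5 c x u = 0 \<and> e 6 c x u = 0 \<and> e 7 c x u = 0"
  have "u = (\<Sum>i\<in>{1..4}. e i c x u *\<^sub>R E i c x)"
    using expansion[OF assms, of u] 0 unfolding index_set7 index_set4 by (simp add: add.assoc)
  also have "\<dots> \<in> horizontal c x"
    unfolding horizontal_def by (intro span_sum span_scale span_base) auto
  finally show "u \<in> horizontal c x" .
qed

lemma subspace_horizontal: "subspace (horizontal c x)"
  by (simp add: horizontal_def)

lemma horizontal_eq_kernel:
  assumes "c \<in> A" "x \<in> snd c ` fst c"
  shows "horizontal c x = {v. \<forall>r. contact r c x v = 0}"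
  using horizontal_iff[OF assms] by (auto simp: forall_3 triple_def)

lemma dim_horizontal:
  assumes "c \<in> A" "x \<in> snd c ` fst c"
  shows "dim (horizontal c x) = 4"
proof -
  have "inj_on (\<lambda>i. E i c x) {1..4}" "independent ((\<lambda>i. E i c x) ` {1..4})"
    using dual_family_independent[of "{1..4::nat}" "\<lambda>i. e i c x" "\<lambda>i. E i c x"] assms
    by (simp_all add: linear_e dual)
  moreover have "{E i c x | i. i \<in> {1..4}} = (\<lambda>i. E i c x) ` {1..4}" by auto
  ultimately show ?thesis
    unfolding horizontal_def by (simp add: dim_span dim_eq_card_independent card_image)
qed

lemma transition:
  assumes "c \<in> A" "d \<in> A" "x \<in> snd c ` (fst c \<inter> fst d)"
  shows "i \<in> {1..7} \<Longrightarrow> e i d (local_rep id c d x) (tangent_rep id c d x v) = e i c x v"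
    and "i \<in> {1..7} \<Longrightarrow> tangent_rep id c d x (E i c x) = E i d (local_rep id c d x)"
    and "linear (tangent_rep id c d x)"
proof -
  show "e i d (local_rep id c d x) (tangent_rep id c d x v) = e i c x v" if "i \<in> {1..7}"
  proof -
    have "e i c x v = e i d (local_rep id c d x) (tangent_rep id c d x v)"
      using form[OF that] assms unfolding one_form_def pullback1_def by blast
    then show ?thesis by simp
  qed
  show "tangent_rep id c d x (E i c x) = E i d (local_rep id c d x)" if "i \<in> {1..7}"
  proof -
    have "E i d (local_rep id c d x) = tangent_rep id c d x (E i c x)"
      using field[OF that] assms unfolding vector_field_def by blast
    then show ?thesis by simp
  qed
  have "smooth_on (snd c ` (fst c \<inter> fst d)) (local_rep id c d)"
    using atlas assms unfolding smooth_atlas_def by blast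
  from smooth_on_has_derivative[OF this assms(3)] show "linear (tangent_rep id c d x)"
    unfolding tangent_rep_def by (rule has_derivative_linear)
qed

lemma smooth_e_apply:
  assumes "c \<in> A" "i \<in> {1..7}" "smooth_on (snd c ` fst c) X"
  shows "smooth_on (snd c ` fst c) (\<lambda>x. e i c x (X x))"
  by (rule smooth_on_linear_apply[where \<alpha>="e i c", OF open_chart[OF assms(1)] linear_e smooth_e assms(3)])
     (use assms in auto)

lemma metric_on_horizontal: "metric_on_distribution A horizontal hor_metric"
  unfolding metric_on_distribution_def
proof (intro conjI ballI allI impI)
  fix c x u v w and a b :: real
  assume c: "c \<in> A" "x \<in> snd c ` fst c"
  show "hor_metric c x (a *\<^sub>R u + b *\<^sub>R v) w = a * hor_metric c x u w + b * hor_metric c x v w"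
    unfolding hor_metric_def sum_distrib_left sum.distrib[symmetric]
    by (intro sum.cong refl) (auto simp: linear_add[OF linear_e[OF c]] linear_cmul[OF linear_e[OF c]] algebra_simps)
  show "hor_metric c x u v = hor_metric c x v u"
    by (simp add: hor_metric_def mult.commute)
  assume u: "u \<in> horizontal c x" and "u \<noteq> 0"
  have "\<exists>i\<in>{1..4}. e i c x u \<noteq> 0"
  proof (rule ccontr)
    assume "\<not> (\<exists>i\<in>{1..4}. e i c x u \<noteq> 0)"
    then have "e i c x u = e i c x 0" if "i \<in> {1..7}" for i
      using u that linear_0[OF linear_e[OF c that]] unfolding horizontal_iff[OF c] index_set7 index_set4 by auto
    then have "u = 0" by (rule frame_eqI[OF c])
    with \<open>u \<noteq> 0\<close> show False by simp
  qed
  then show "0 < hor_metric c x u u"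
    unfolding hor_metric_def by (auto intro!: sum_pos2 simp: zero_less_mult_iff)
next
  fix c X Y
  assume "c \<in> A" "smooth_on (snd c ` fst c) X \<and> smooth_on (snd c ` fst c) Y \<and>
    (\<forall>x\<in>snd c ` fst c. X x \<in> horizontal c x \<and> Y x \<in> horizontal c x)"
  then show "smooth_on (snd c ` fst c) (\<lambda>x. hor_metric c x (X x) (Y x))"
    unfolding hor_metric_def by (intro smooth_on_sum smooth_on_mult smooth_e_apply open_chart) auto
next
  fix c d x u v
  assume "c \<in> A" "d \<in> A" "x \<in> snd c ` (fst c \<inter> fst d)"
  then show "hor_metric c x u v = hor_metric d (local_rep id c d x) (tangent_rep id c d x u) (tangent_rep id c d x v)"
    unfolding hor_metric_def by (intro sum.cong refl) (auto simp: transition)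
qed

lemma smooth_fundamental_form:
  assumes c: "c \<in> A" and "smooth_on (snd c ` fst c) X" "smooth_on (snd c ` fst c) Y"
  shows "smooth_on (snd c ` fst c) (\<lambda>x. fundamental_forms e r c x (X x) (Y x))"
proof -
  have *: "smooth_on (snd c ` fst c) (\<lambda>x. wedge (e i) (e j) c x (X x) (Y x))"
    if "i \<in> {1..7}" "j \<in> {1..7}" for i j
    unfolding wedge_def
    using that assms by (intro smooth_on_diff smooth_on_mult smooth_e_apply open_chart) auto
  show ?thesis
    unfolding fundamental_forms_def Let_def triple_def
    by (cases "r = 1"; cases "r = 2") (simp_all add: smooth_on_add open_chart[OF c] *)
qed

lemma linear_fundamental_form:
  assumes "c \<in> A" "x \<in> snd c ` fst c"
  shows "fundamental_forms e r c x (a *\<^sub>R u + b *\<^sub>R v) w =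
    a * fundamental_forms e r c x u w + b * fundamental_forms e r c x v w"
  by (simp add: fundamental_forms_def Let_def triple_def wedge_def algebra_simps
      linear_add[OF linear_e[OF assms]] linear_cmul[OF linear_e[OF assms]])

lemma hor_acs_horizontal: "hor_acs r c x u \<in> horizontal c x"
  unfolding hor_acs_def horizontal_def by (intro span_sum span_scale span_base) auto

lemma endo_of_horizontal: "endo_of_distribution A horizontal (hor_acs r)"
  unfolding endo_of_distribution_def
proof (intro conjI ballI allI impI)
  fix c x u v and a b :: real
  assume c: "c \<in> A" "x \<in> snd c ` fst c"
  show "hor_acs r c x u \<in> horizontal c x" by (rule hor_acs_horizontal)
  show "hor_acs r c x (a *\<^sub>R u + b *\<^sub>R v) = a *\<^sub>R hor_acs r c x u + b *\<^sub>R hor_acs r c x v"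
    by (simp add: hor_acs_def linear_fundamental_form[OF c] scaleR_add_left sum.distrib scaleR_sum_right)
next
  fix c X
  assume "c \<in> A" "smooth_on (snd c ` fst c) X \<and> (\<forall>x\<in>snd c ` fst c. X x \<in> horizontal c x)"
  then show "smooth_on (snd c ` fst c) (\<lambda>x. hor_acs r c x (X x))"
    unfolding hor_acs_def by (intro smooth_on_sum smooth_on_scaleR smooth_fundamental_form open_chart) (auto intro: smooth_E)
next
  fix c d x u
  assume cd: "c \<in> A" "d \<in> A" "x \<in> snd c ` (fst c \<inter> fst d)"
  have "fundamental_forms e r d (local_rep id c d x) (tangent_rep id c d x u) (tangent_rep id c d x v) =
      fundamental_forms e r c x u v" for v
    by (simp add: fundamental_forms_def Let_def wedge_def transition(1)[OF cd])
  then have "fundamental_forms e r d (local_rep id c d x) (tangent_rep id c d x u) (E j d (local_rep id c d x)) =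
      fundamental_forms e r c x u (E j c x)" if "j \<in> {1..4}" for j
    using that by (simp flip: transition(2)[OF cd])
  then show "tangent_rep id c d x (hor_acs r c x u) = hor_acs r d (local_rep id c d x) (tangent_rep id c d x u)"
    unfolding hor_acs_def linear_sum[OF transition(3)[OF cd]] linear_cmul[OF transition(3)[OF cd]]
    by (intro sum.cong) (auto simp: transition(2)[OF cd])
qed

lemma e_hor_acs:
  assumes "c \<in> A" "x \<in> snd c ` fst c"
  shows "i \<in> {1..7} \<Longrightarrow> e i c x (hor_acs r c x u) = (if i \<in> {1..4} then fundamental_forms e r c x u (E i c x) else 0)"
  unfolding hor_acs_def using e_frame_sum[OF assms] by simp

lemma e_hor_acs_components:
  assumes "c \<in> A" "x \<in> snd c ` fst c"
  shows "e 1 c x (hor_acs r c x u) = - triple (e 2 c x u) (e 3 c x u) (e 4 c x u) r"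
    "e 2 c x (hor_acs r c x u) = triple (e 1 c x u) (e 4 c x u) (- e 3 c x u) r"
    "e 3 c x (hor_acs r c x u) = triple (- e 4 c x u) (e 1 c x u) (e 2 c x u) r"
    "e 4 c x (hor_acs r c x u) = triple (e 3 c x u) (- e 2 c x u) (e 1 c x u) r"
    "e 5 c x (hor_acs r c x u) = 0" "e 6 c x (hor_acs r c x u) = 0" "e 7 c x (hor_acs r c x u) = 0"
  by (simp_all add: e_hor_acs[OF assms] fundamental_forms_def Let_def wedge_def dual[OF assms] triple_def del: One_nat_def)

lemma frame_eqI7:
  assumes "c \<in> A" "x \<in> snd c ` fst c"
    "e 1 c x u = e 1 c x v" "e 2 c x u = e 2 c x v" "e 3 c x u = e 3 c x v" "e 4 c x u = e 4 c x v"
    "e 5 c x u = e 5 c x v" "e 6 c x u = e 6 c x v" "e 7 c x u = e 7 c x v"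
  shows "u = v"
proof (rule frame_eqI[OF assms(1,2)])
  show "e i c x u = e i c x v" if "i \<in> {1..7}" for i
    using that assms(3-) unfolding index_set7 by blast
qed

lemma quaternionic_identities:
  assumes c: "c \<in> A" "x \<in> snd c ` fst c" and u: "u \<in> horizontal c x"
  shows "hor_acs r c x (hor_acs r c x u) = - u" "hor_acs 1 c x (hor_acs 2 c x u) = hor_acs 3 c x u"
    "hor_acs 2 c x (hor_acs 1 c x u) = - hor_acs 3 c x u"
proof -
  have neg: "e i c x (- v) = - e i c x v" if "i \<in> {1..7}" for i v
    using linear_neg[OF linear_e[OF c that]] .
  note comp = e_hor_acs_components[OF c] neg horizontal_iff[OF c]
  have "r = 1 \<or> r = 2 \<or> r = 3" by (rule exhaust_3)
  then show "hor_acs r c x (hor_acs r c x u) = - u"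
    using u by (elim disjE; intro frame_eqI7[OF c]; simp add: comp del: One_nat_def)
  show "hor_acs 1 c x (hor_acs 2 c x u) = hor_acs 3 c x u" "hor_acs 2 c x (hor_acs 1 c x u) = - hor_acs 3 c x u"
    by (intro frame_eqI7[OF c]; simp add: comp del: One_nat_def)+
qed

lemma metric_compatible:
  assumes c: "c \<in> A" "x \<in> snd c ` fst c" and u: "u \<in> horizontal c x" and v: "v \<in> horizontal c x"
  shows "hor_metric c x (hor_acs r c x u) v = fundamental_forms e r c x u v"
    "hor_metric c x (hor_acs r c x u) (hor_acs r c x v) = hor_metric c x u v"
    "ext_deriv (contact r) c x u v = 2 * fundamental_forms e r c x u v"
proof -
  have r: "r = 1 \<or> r = 2 \<or> r = 3" by (rule exhaust_3)
  show "hor_metric c x (hor_acs r c x u) v = fundamental_forms e r c x u v"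
    "hor_metric c x (hor_acs r c x u) (hor_acs r c x v) = hor_metric c x u v"
    "ext_deriv (contact r) c x u v = 2 * fundamental_forms e r c x u v"
    using r u v
    by (elim disjE; simp add: hor_metric_def index_set4 e_hor_acs_components[OF c] horizontal_iff[OF c] de[OF c]
        fundamental_forms_def Let_def wedge_def algebra_simps del: One_nat_def)+
qed

lemma one_form_contact: "one_form A (contact r)"
  using form by (simp add: triple_def)

lemma qc_structure_G2: "qc_structure A horizontal hor_metric contact hor_acs"
  unfolding qc_structure_def
proof (intro conjI ballI allI)
  fix c x assume c: "c \<in> A" "x \<in> snd c ` fst c"
  show "subspace (horizontal c x)" by (rule subspace_horizontal)
  show "dim (horizontal c x) = 4" by (rule dim_horizontal[OF c])
  show "horizontal c x = {v. \<forall>r. contact r c x v = 0}" by (rule horizontal_eq_kernel[OF c])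
  fix u assume u: "u \<in> horizontal c x"
  show "hor_acs r c x (hor_acs r c x u) = - u" "hor_acs 1 c x (hor_acs 2 c x u) = hor_acs 3 c x u"
    "hor_acs 2 c x (hor_acs 1 c x u) = - hor_acs 3 c x u" for r
    by (rule quaternionic_identities[OF c u])+
  fix v assume v: "v \<in> horizontal c x"
  show "hor_metric c x (hor_acs r c x u) (hor_acs r c x v) = hor_metric c x u v"
    "2 * hor_metric c x (hor_acs r c x u) v = ext_deriv (contact r) c x u v" for r
    using metric_compatible[OF c u v] by simp_all
qed (simp_all add: one_form_contact metric_on_horizontal endo_of_horizontal)

text \<open>No correction of \<open>E\<^sub>5\<close>, \<open>E\<^sub>6\<close>, \<open>E\<^sub>7\<close> by horizontal fields is necessary: on \<open>E\<^sub>4\<^sub>+\<^sub>r\<close> and \<open>H\<close> the only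
  non-zero terms of \<open>de\<^sup>5\<close>, \<open>de\<^sup>6\<close>, \<open>de\<^sup>7\<close> are \<open>- e\<^sup>4\<^sup>6\<close> and \<open>e\<^sup>4\<^sup>5\<close>, which have opposite signs.\<close>

lemma qc_integrable_G2: "qc_integrable A horizontal contact"
  unfolding qc_integrable_def
proof (intro exI conjI ballI allI)
  show "vector_field A (triple (E 5) (E 6) (E 7) r)" for r
    using field by (simp add: triple_def)
  fix c x and r s :: 3 assume c: "c \<in> A" "x \<in> snd c ` fst c"
  have r: "r = 1 \<or> r = 2 \<or> r = 3" and s: "s = 1 \<or> s = 2 \<or> s = 3" by (rule exhaust_3)+
  show "contact s c x (triple (E 5) (E 6) (E 7) r c x) = (if r = s then 1 else 0)"
    using r s by (elim disjE; simp add: dual[OF c])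
  fix u assume u: "u \<in> horizontal c x"
  show "ext_deriv (contact s) c x (triple (E 5) (E 6) (E 7) s c x) u = 0"
    using s u by (elim disjE; simp add: dual[OF c] de[OF c] wedge_def horizontal_iff[OF c] del: One_nat_def)
  show "ext_deriv (contact s) c x (triple (E 5) (E 6) (E 7) r c x) u =
      - ext_deriv (contact r) c x (triple (E 5) (E 6) (E 7) s c x) u"
    using r s u by (elim disjE; simp add: dual[OF c] de[OF c] wedge_def horizontal_iff[OF c] del: One_nat_def)
qed

end

section \<open>Maps to the quaternionic Heisenberg group\<close>

text \<open>The horizontal fields have natural numbers as indices, the standard basis of \<open>\<real>\<^sup>4\<close> has the elements
  of the type \<open>4\<close>, in which \<open>4 = 0\<close>.\<close>

definition hor_index :: "4 \<Rightarrow> nat" where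
  "hor_index i = (if i = 1 then 1 else if i = 2 then 2 else if i = 3 then 3 else 4)"

lemma hor_index_range: "hor_index i \<in> {1..4}" and hor_index_surj: "n \<in> {1..4} \<Longrightarrow> \<exists>i. hor_index i = n"
  and hor_index_inj: "hor_index i = hor_index j \<longleftrightarrow> i = j"
proof -
  show "hor_index i \<in> {1..4}" by (simp add: hor_index_def)
  show "\<exists>i. hor_index i = n" if "n \<in> {1..4}"
  proof -
    have "hor_index 1 = 1" "hor_index 2 = 2" "hor_index 3 = 3" "hor_index 4 = 4" by (simp_all add: hor_index_def)
    then show ?thesis using that unfolding index_set4 by blast
  qed
  show "hor_index i = hor_index j \<longleftrightarrow> i = j"
    using exhaust_4[of i] exhaust_4[of j] by (auto simp: hor_index_def)
qed

context G2_frame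
begin

text \<open>The vertical parts \<open>-2 \<omega>\<^sub>s(E\<^sub>i, E\<^sub>j) E\<^sub>4\<^sub>+\<^sub>s\<close> of the two brackets are equal in each line and cancel.\<close>

lemma antiselfdual_brackets:
  fixes f :: "real^7 \<Rightarrow> 'c::euclidean_space"
  assumes "c \<in> A" "V \<subseteq> snd c ` fst c" "open V" "smooth_on V f" "x \<in> V"
  defines "D \<equiv> \<lambda>i. along (E i c)"
  shows "D 1 (D 2 f) x - D 2 (D 1 f) x - (D 3 (D 4 f) x - D 4 (D 3 f) x) = (-1) *\<^sub>R D 2 f x"
    "D 1 (D 3 f) x - D 3 (D 1 f) x - (D 4 (D 2 f) x - D 2 (D 4 f) x) = (5/3) *\<^sub>R D 3 f x"
    "D 1 (D 4 f) x - D 4 (D 1 f) x - (D 2 (D 3 f) x - D 3 (D 2 f) x) = (2/3) *\<^sub>R D 4 f x"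
proof -
  have x: "x \<in> snd c ` fst c" using assms by blast
  note br = frame_bracket[OF assms(1-5)]
  have sum: "v + (2/3) *\<^sub>R v = (5/3) *\<^sub>R v" "(1/3) *\<^sub>R v + (2/3) *\<^sub>R v = v" for v :: 'c
    using scaleR_add_left[of 1 "2/3" v] scaleR_add_left[of "1/3" "2/3" v] by simp_all
  show "D 1 (D 2 f) x - D 2 (D 1 f) x - (D 3 (D 4 f) x - D 4 (D 3 f) x) = (-1) *\<^sub>R D 2 f x"
    "D 1 (D 3 f) x - D 3 (D 1 f) x - (D 4 (D 2 f) x - D 2 (D 4 f) x) = (5/3) *\<^sub>R D 3 f x"
    "D 1 (D 4 f) x - D 4 (D 1 f) x - (D 2 (D 3 f) x - D 3 (D 2 f) x) = (2/3) *\<^sub>R D 4 f x"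
    unfolding D_def using br[of 1 2] br[of 3 4] br[of 1 3] br[of 4 2] br[of 1 4] br[of 2 3]
    by (simp_all add: index_set7 de[OF assms(1) x] wedge_def dual[OF assms(1) x] del: One_nat_def)
       (simp_all add: algebra_simps sum)
qed

lemma contact_bracket:
  assumes "c \<in> A" "x \<in> snd c ` fst c"
  shows "ext_deriv (triple (e 5) (e 6) (e 7) s) c x (E (hor_index i) c x) (E (hor_index j) c x) =
    2 * heis_omega s (axis i 1) (axis j 1)"
proof -
  have s: "s = 1 \<or> s = 2 \<or> s = 3" by (rule exhaust_3)
  have i: "i = 1 \<or> i = 2 \<or> i = 3 \<or> i = 4" and j: "j = 1 \<or> j = 2 \<or> j = 3 \<or> j = 4" by (rule exhaust_4)+
  show ?thesis
    using s i j
    by (elim disjE; simp add: triple_def de[OF assms] hor_index_def wedge_def dual[OF assms] heis_omega_def Let_def axis_def del: One_nat_def)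
qed

text \<open>Here \<open>\<theta> X r\<close> is the pullback of the flat contact form evaluated on the field \<open>X\<close>.  It vanishes for
  horizontal \<open>X\<close>, hence so does its derivative along \<open>H\<close>, and no derivative of \<open>\<nu>\<close> or \<open>\<Psi>\<close> is ever taken.\<close>

lemma not_locally_qc_conformally_flat: "\<not> locally_qc_conformally_flat A (triple (e 5) (e 6) (e 7))"
proof
  let ?\<eta> = "triple (e 5) (e 6) (e 7)"
  assume "locally_qc_conformally_flat A ?\<eta>"
  \<comment> \<open>Every point leads to a contradiction, so the choice of the point does not matter.\<close>
  then obtain U F \<nu> \<Psi> where p: "(undefined :: 'a) \<in> U"
    and diffeo: "diffeomorphism_onto_open A {std_chart} U (F :: 'a \<Rightarrow> heis)"
    and \<nu>: "\<forall>q\<in>U. 0 < \<nu> q" and \<Psi>: "\<forall>q\<in>U. rotation_matrix (\<Psi> q :: real^3^3)"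
    and flat: "\<forall>c\<in>A. \<forall>q\<in>fst c \<inter> U. \<forall>v r. pullback1 F c std_chart (heis_contact r) (snd c q) v =
             \<nu> q * (\<Sum>s\<in>UNIV. \<Psi> q $ r $ s * ?\<eta> s c (snd c q) v)"
    unfolding locally_qc_conformally_flat_def
    by (elim allE[of _ "undefined :: 'a"] exE conjE) (rule that)
  obtain c where c: "c \<in> A" "(undefined :: 'a) \<in> fst c"
    using atlas unfolding smooth_atlas_def by blast
  define V where "V = snd c ` (fst c \<inter> U)"
  define f where "f = local_rep F c std_chart"
  define q where "q x = fst (f x)" for x
  define w where "w r x = snd (f x) $ r" for r x
  define N where "N x = \<nu> (chart_inv c x)" for x
  define R where "R x = \<Psi> (chart_inv c x)" for x
  have V: "open V" "V \<subseteq> snd c ` fst c" "V \<noteq> {}"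
    using diffeo c p open_chart_image[OF c(1)] by (auto simp: V_def diffeomorphism_onto_open_def)
  have smooth_f: "smooth_on V f"
    using diffeo c(1) unfolding diffeomorphism_onto_open_def smooth_map_on_def V_def f_def by simp
  have smooth_q: "smooth_on V q"
    unfolding q_def by (rule smooth_on_bounded_linear[OF bounded_linear_fst V(1) smooth_f])
  have blw: "bounded_linear (\<lambda>z::heis. snd z $ r)" for r
    by (rule bounded_linear_compose[OF bounded_linear_vec_nth bounded_linear_snd])
  have smooth_w: "smooth_on V (w r)" for r
    unfolding w_def by (rule smooth_on_bounded_linear[OF blw V(1) smooth_f])
  define \<theta> where "\<theta> X r x = along X (w r) x / 2 + heis_omega r (q x) (along X q x)" for X r x
  have pull: "\<theta> X r x = N x * (\<Sum>s\<in>UNIV. R x $ r $ s * ?\<eta> s c x (X x))" if x: "x \<in> V" for X r x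
  proof -
    obtain y where y: "y \<in> fst c \<inter> U" "x = snd c y" using x by (auto simp: V_def)
    have "along X q x = fst (along X f x)" "along X (w r) x = snd (along X f x) $ r"
      unfolding q_def[abs_def] w_def[abs_def]
      using smooth_on_differentiable[OF smooth_f x]
      by (auto intro: along_bounded_linear bounded_linear_fst blw)
    then have "\<theta> X r x = pullback1 F c std_chart (heis_contact r) x (X x)"
      by (simp add: \<theta>_def pullback1_def heis_contact_def tangent_rep_def f_def[symmetric] q_def along_def)
    also have "\<dots> = N x * (\<Sum>s\<in>UNIV. R x $ r $ s * ?\<eta> s c x (X x))"
      using flat c(1) y chart_inv[OF c(1)] by (simp add: N_def R_def)
    finally show ?thesis .
  qed
  have xV: "x \<in> snd c ` fst c" if "x \<in> V" for x
    using V that by blast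
  have horizontal_\<theta>: "\<theta> (E i c) r x = 0" if "x \<in> V" "i \<in> {1..4}" for x r i
    using that by (simp add: pull sum_3 triple_def dual[OF c(1) xV])
  have smE: "smooth_on V (E i c)" if "i \<in> {1..7}" for i
    using smooth_E[OF c(1) that] V(2) by (rule smooth_on_subset)
  have omega: "heis_omega r (along (E (hor_index i) c) q x) (along (E (hor_index j) c) q x) =
      N x * (\<Sum>s\<in>UNIV. R x $ r $ s * heis_omega s (axis i 1) (axis j 1))" if x: "x \<in> V" for x r i j
  proof -
    let ?D = "\<lambda>i. along (E i c)" and ?i = "hor_index i" and ?j = "hor_index j"
    have ij: "?i \<in> {1..4}" "?j \<in> {1..4}" "?i \<in> {1..7}" "?j \<in> {1..7}"
      using hor_index_range[of i] hor_index_range[of j] by auto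
    interpret \<omega>: bounded_bilinear "heis_omega r" by (rule bounded_bilinear_heis_omega)
    \<comment> \<open>Skew-symmetrising the derivative of \<open>\<theta> (E\<^sub>n) r = 0\<close> along \<open>E\<^sub>m\<close> leaves the commutators of the
      components of \<open>F\<close>, which reassemble to \<open>\<theta>\<close> on the bracket.\<close>
    have alt: "heis_omega r a b = - heis_omega r b a" for a b
      by (simp add: heis_omega_def triple_def Let_def)
    have D\<theta>: "?D m (?D n (w r)) x / 2 + heis_omega r (q x) (?D m (?D n q) x)
        + heis_omega r (?D m q x) (?D n q x) = 0" if "m \<in> {1..7}" "n \<in> {1..4}" for m n
    proof -
      have n: "n \<in> {1..7}" using that by auto
      have smw: "smooth_on V (?D n (w r))" and smq: "smooth_on V (?D n q)"
        by (intro smooth_on_along V(1) smE[OF n] smooth_w smooth_q)+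
      note d = smooth_on_differentiable[OF smw x] smooth_on_differentiable[OF smq x] smooth_on_differentiable[OF smooth_q x]
      have "?D m (\<lambda>y. ?D n (w r) y / 2 + heis_omega r (q y) (?D n q y)) x = 0"
        using horizontal_\<theta> that by (intro along_const_on[OF V(1) x]) (auto simp: \<theta>_def)
      moreover have "?D m (\<lambda>y. ?D n (w r) y / 2 + heis_omega r (q y) (?D n q y)) x =
          ?D m (\<lambda>y. ?D n (w r) y / 2) x + ?D m (\<lambda>y. heis_omega r (q y) (?D n q y)) x"
        using d smooth_on_differentiable[OF smooth_on_bilinear[OF bounded_bilinear_heis_omega V(1) smooth_q smq] x]
        by (intro along_add differentiable_divide) auto
      moreover have "?D m (\<lambda>y. ?D n (w r) y / 2) x = ?D m (?D n (w r)) x / 2"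
        using along_bounded_linear[OF bounded_linear_divide d(1)] .
      ultimately show ?thesis
        using along_bilinear[OF bounded_bilinear_heis_omega d(3,2)] by simp
    qed
    have "2 * heis_omega r (?D ?i q x) (?D ?j q x) =
        - ((?D ?i (?D ?j (w r)) x - ?D ?j (?D ?i (w r)) x) / 2
          + heis_omega r (q x) (?D ?i (?D ?j q) x - ?D ?j (?D ?i q) x))"
      using D\<theta>[OF ij(3,2)] D\<theta>[OF ij(4,1)] alt[of "?D ?j q x" "?D ?i q x"]
      by (simp add: \<omega>.diff_right field_simps)
    also have "\<dots> = (\<Sum>k=1..7. ext_deriv (e k) c x (E ?i c x) (E ?j c x) * \<theta> (E k c) r x)"
      unfolding frame_bracket[OF c(1) V(2,1) smooth_w x ij(3,4)] frame_bracket[OF c(1) V(2,1) smooth_q x ij(3,4)]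
      by (simp add: \<theta>_def \<omega>.minus_right \<omega>.sum_right \<omega>.scaleR_right sum.distrib distrib_left sum_divide_distrib)
    also have "\<dots> = N x * (\<Sum>s\<in>UNIV. R x $ r $ s * ext_deriv (?\<eta> s) c x (E ?i c x) (E ?j c x))"
      by (simp add: pull[OF x] index_set7 sum_3 triple_def dual[OF c(1) xV[OF x]] algebra_simps del: One_nat_def)
    also have "\<dots> = 2 * (N x * (\<Sum>s\<in>UNIV. R x $ r $ s * heis_omega s (axis i 1) (axis j 1)))"
      by (simp add: contact_bracket[OF c(1) xV[OF x]] sum_3 algebra_simps)
    finally show ?thesis by simp
  qed
  have N: "N x > 0" and R: "rotation_matrix (R x)" if "x \<in> V" for x
    using that \<nu> \<Psi> chart_inv[OF c(1)] by (auto simp: V_def N_def R_def)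
  interpret conformal_frame V "\<lambda>i. E i c" q N
  proof
    show "along (E i c) q x \<bullet> along (E j c) q x = (if i = j then N x else 0)"
      if x: "x \<in> V" and ij: "i \<in> {1..4}" "j \<in> {1..4}" for x i j
    proof -
      obtain i' j' where *: "i = hor_index i'" "j = hor_index j'" using hor_index_surj[OF ij(1)] hor_index_surj[OF ij(2)] by metis
      have "along (E (hor_index i') c) q x \<bullet> along (E (hor_index j') c) q x = (if i' = j' then N x else 0)"
        by (rule quaternionic_frame_conformal[OF N[OF x] R[OF x] omega[OF x]])
      then show ?thesis by (simp add: * hor_index_inj)
    qed
  qed (use V smE smooth_q N in auto)
  show False
    by (rule no_G2_brackets[OF V(3)]) (rule antiselfdual_brackets[OF c(1) V(2,1)]; assumption)+
qed

end

theorem proposition4p6: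
  fixes A :: "('a::{t2_space, second_countable_topology}, real^7) chart set"
    and G :: "'a monoid"
    and e :: "nat \<Rightarrow> ('a, real^7) form1"
    and E :: "nat \<Rightarrow> ('a, real^7) vfield"
    and \<eta> :: "3 \<Rightarrow> ('a, real^7) form1"
    and H :: "('a, real^7) distribution"
    and g :: "('a, real^7) form2"
  assumes "lie_group A G" and "simply_connected (UNIV :: 'a set)" and "solvable G"
    and "\<And>i. i \<in> {1..7} \<Longrightarrow> one_form A (e i) \<and> left_invariant_form A G (e i)"
    and "\<And>i. i \<in> {1..7} \<Longrightarrow> vector_field A (E i) \<and> left_invariant_vfield A G (E i)"
    and "\<And>c x i j. c \<in> A \<Longrightarrow> x \<in> snd c ` fst c \<Longrightarrow> i \<in> {1..7} \<Longrightarrow> j \<in> {1..7} \<Longrightarrow>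
           e i c x (E j c x) = (if i = j then 1 else 0)"
    and "G2_structure_equations A e"
    and "\<eta> = triple (e 5) (e 6) (e 7)"
    and "H = (\<lambda>c x. span {E i c x | i. i \<in> {1..4}})"
    and "g = (\<lambda>c x u v. \<Sum>i=1..4. e i c x u * e i c x v)"
  shows "(\<exists>I. qc_structure A H g \<eta> I \<and>
           (\<forall>c\<in>A. \<forall>x\<in>snd c ` fst c. \<forall>u\<in>H c x. \<forall>v\<in>H c x. \<forall>r.
              fundamental_forms e r c x u v = g c x (I r c x u) v)) \<and>
         qc_integrable A H \<eta> \<and>
         \<not> locally_qc_conformally_flat A \<eta>"
proof -
  interpret G2_frame A e E
    using assms(1,4-7) by unfold_locales (auto simp: lie_group_def)
  have H: "H = horizontal" and g: "g = hor_metric"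
    by (simp_all add: assms(9,10) horizontal_def hor_metric_def fun_eq_iff)
  show ?thesis
    unfolding H g assms(8) using qc_structure_G2 metric_compatible(1) qc_integrable_G2 not_locally_qc_conformally_flat by metis
qed

end
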